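(* Fix $r\ge1$. The family $(A_c^q)_c$, indexed by $c=(c_1,\dots,c_r)\in\mathbb{N}^r$ with $c_1+\dots+c_r=r$, satisfies: (a) $A^q_{(1,1,\dots,1)}=[r]_q!$; (b) for every $i\in\{1,\dots,r\}$ with $c_i\ge2$, $$(q+1)A^q_{(c_1,\dots,c_r)}=qA^q_{(c_1,\dots,c_{i-1}+1,c_i-1,\dots,c_r)}+A^q_{(c_1,\dots,c_i-1,c_{i+1}+1,\dots,c_r)},$$ where for $i=1$ the first term on the right is omitted and for $i=r$ the second term on the right is omitted. Moreover, it is the unique family of elements of $\mathbf{k}$ indexed by these $c$ satisfying (a) and (b).
   Context: Let $\mathbf{k}$ be a field of characteristic zero and $q\in\mathbf{k}$ not a nontrivial root of unity; $[m]_q!=\prod_{i=1}^m(1+q+\dots+q^{i-1})$. For $1\le j\le n-1$, $s_j$ swaps $x_j,x_{j+1}$, $\partial_j g=(g-s_jg)/(x_j-x_{j+1})$, $T_j(g)=(q-1)\partial_j(x_jg)+s_jg$; $T_w=T_{j_1}\cdots T_{j_\ell}$ for a reduced word of $w\in S_n$. The $q$-divided symmetrization is $\langle f\rangle_n^q=\sum_{w\in S_n}T_w\big(f/\prod_{j=1}^{n-1}(qx_j-x_{j+1})\big)$. For $c=(c_1,\dots,c_r)\in\mathbb{N}^r$ let $y_c=\prod_{i=1}^r(x_1+\dots+x_i)^{c_i}$, and for $c_1+\dots+c_r=r$ define the remixed Eulerian number $A_c^q=\langle y_c\rangle_{r+1}^q$ (qDS in $x_1,\dots,x_{r+1}$).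 *)

theory Defs
  imports Main "HOL-Combinatorics.Permutations"
begin

(* Rational functions in x_1..x_n are represented by functions (nat => 'k) => 'k,
   evaluated at points x (variable x_i is x i).  Operators act pointwise. *)

definition swap_pt :: "nat \<Rightarrow> (nat \<Rightarrow> 'k) \<Rightarrow> (nat \<Rightarrow> 'k)" where
  "swap_pt j x = (\<lambda>i. if i = j then x (Suc j) else if i = Suc j then x j else x i)"

definition sact :: "nat \<Rightarrow> ((nat \<Rightarrow> 'k) \<Rightarrow> 'k) \<Rightarrow> ((nat \<Rightarrow> 'k) \<Rightarrow> 'k)" where
  "sact j g = (\<lambda>x. g (swap_pt j x))"

definition ddiff :: "nat \<Rightarrow> ((nat \<Rightarrow> 'k::field) \<Rightarrow> 'k) \<Rightarrow> ((nat \<Rightarrow> 'k) \<Rightarrow> 'k)" where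
  "ddiff j g = (\<lambda>x. (g x - sact j g x) / (x j - x (Suc j)))"

definition Tq :: "'k::field \<Rightarrow> nat \<Rightarrow> ((nat \<Rightarrow> 'k) \<Rightarrow> 'k) \<Rightarrow> ((nat \<Rightarrow> 'k) \<Rightarrow> 'k)" where
  "Tq q j g = (\<lambda>x. (q - 1) * ddiff j (\<lambda>y. y j * g y) x + sact j g x)"

definition T_word :: "'k::field \<Rightarrow> nat list \<Rightarrow> ((nat \<Rightarrow> 'k) \<Rightarrow> 'k) \<Rightarrow> ((nat \<Rightarrow> 'k) \<Rightarrow> 'k)" where
  "T_word q js g = foldr (Tq q) js g"

definition str :: "nat \<Rightarrow> nat \<Rightarrow> nat" where
  "str j = (\<lambda>i. if i = j then Suc j else if i = Suc j then j else i)"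

definition perm_of_word :: "nat list \<Rightarrow> (nat \<Rightarrow> nat)" where
  "perm_of_word js = foldr (\<lambda>j w. str j \<circ> w) js id"

definition is_word :: "nat \<Rightarrow> nat list \<Rightarrow> bool" where
  "is_word n js \<longleftrightarrow> set js \<subseteq> {1..<n}"

definition reduced_word :: "nat \<Rightarrow> (nat \<Rightarrow> nat) \<Rightarrow> nat list \<Rightarrow> bool" where
  "reduced_word n w js \<longleftrightarrow> is_word n js \<and> perm_of_word js = w \<and>
     (\<forall>ks. is_word n ks \<and> perm_of_word ks = w \<longrightarrow> length js \<le> length ks)"

definition T_perm :: "'k::field \<Rightarrow> nat \<Rightarrow> (nat \<Rightarrow> nat) \<Rightarrow> ((nat \<Rightarrow> 'k) \<Rightarrow> 'k) \<Rightarrow> ((nat \<Rightarrow> 'k) \<Rightarrow> 'k)" where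
  "T_perm q n w g = T_word q (SOME js. reduced_word n w js) g"

definition qDS :: "'k::field \<Rightarrow> nat \<Rightarrow> ((nat \<Rightarrow> 'k) \<Rightarrow> 'k) \<Rightarrow> ((nat \<Rightarrow> 'k) \<Rightarrow> 'k)" where
  "qDS q n f = (\<lambda>x. \<Sum>w\<in>{w. w permutes {1..n}}.
      T_perm q n w (\<lambda>y. f y / (\<Prod>j=1..<n. q * y j - y (Suc j))) x)"

(* points where all the relevant denominators are nonzero *)
definition generic :: "'k::field \<Rightarrow> nat \<Rightarrow> (nat \<Rightarrow> 'k) \<Rightarrow> bool" where
  "generic q n x \<longleftrightarrow> (\<forall>i\<in>{1..n}. \<forall>j\<in>{1..n}. i \<noteq> j \<longrightarrow> x i \<noteq> x j \<and> q * x i \<noteq> x j)"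

definition ymon :: "nat list \<Rightarrow> (nat \<Rightarrow> 'k::field) \<Rightarrow> 'k" where
  "ymon c = (\<lambda>x. \<Prod>i=1..length c. (\<Sum>k=1..i. x k) ^ (c ! (i - 1)))"

(* A_c^q = <y_c>_{r+1}^q, a constant: its value at any generic point *)
definition remixed_eulerian :: "'k::field \<Rightarrow> nat list \<Rightarrow> 'k" where
  "remixed_eulerian q c = (THE a. \<forall>x. generic q (length c + 1) x \<longrightarrow>
       qDS q (length c + 1) (ymon c) x = a)"

definition qint :: "'k::field \<Rightarrow> nat \<Rightarrow> 'k" where
  "qint q m = (\<Sum>k<m. q ^ k)"

definition qfact :: "'k::field \<Rightarrow> nat \<Rightarrow> 'k" where
  "qfact q m = (\<Prod>i=1..m. qint q i)"

(* conditions (a) and (b) for a family B indexed by lists c of length r with sum r;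
    list index i (0-based) corresponds to c_{i+1} *)
definition satisfies_ab :: "'k::field \<Rightarrow> nat \<Rightarrow> (nat list \<Rightarrow> 'k) \<Rightarrow> bool" where
  "satisfies_ab q r B \<longleftrightarrow>
     B (replicate r 1) = qfact q r \<and>
     (\<forall>c. length c = r \<and> sum_list c = r \<longrightarrow>
        (\<forall>i<r. 2 \<le> c ! i \<longrightarrow>
           (q + 1) * B c =
             (if i = 0 then 0 else q * B (c[i - 1 := c ! (i - 1) + 1, i := c ! i - 1]))
           + (if i = r - 1 then 0 else B (c[i := c ! i - 1, Suc i := c ! Suc i + 1]))))"

end

theory Submission
  imports Defs
begin

text \<open>
  Summing the Hecke operators over a symmetric group coset by coset turns the q-divided
  symmetrization into an antisymmetrization: at a generic point x it equals the sum over w of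
  (f P / V)(x w), where V is the product of all x_a - x_b with a < b and P is the product of
  q x_a - x_b over the non-adjacent pairs a < b. Such a sum vanishes as soon as, for some set A of
  variables, f P is a polynomial in A of degree less than card A choose 2 whose coefficients are
  symmetric in A: every monomial then repeats an exponent and is killed by a transposition.

  Write y_i = x_1 + ... + x_i. Relation (b) says that y^e (q x_i - x_{i+1}) symmetrizes to 0
  whenever e_i is positive and e has total degree r - 1. Counting degrees, vanishing applies with A
  the first i variables or with A the remaining ones. For (a), with
  v_i the symmetrization of y_1 ... y_{r-1} y_i, the same relation gives v_i = [i] v_1, while
  the factor q x_r - x_{r+1} reduces the symmetrization to r variables and
  yields [r+1] v_1 = [r+1] [r-1]!.

  Uniqueness: if c_i is at least 2, moving the surplus unit along the maximal block of positive
  entries around i produces a sequence with (q+1) v_j = q v_{j-1} + v_{j+1}. Its two ends have a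
  larger support (or are omitted), so they vanish by induction for the difference of two families, and
  then so does the sequence because the q-integers are nonzero. Applied to the values at two
  generic points, uniqueness also shows that the symmetrization is a constant.
\<close>

section \<open>Hecke operators and words\<close>

lemma swap_pt_str: "swap_pt j x = x \<circ> str j"
  by (auto simp: swap_pt_def str_def)

lemma str_transpose: "str j = transpose j (Suc j)"
  by (auto simp: str_def transpose_def)

lemma str_permutes: "j \<in> {1..<n} \<Longrightarrow> str j permutes {1..n}"
  unfolding str_transpose by (rule permutes_swap_id) auto

lemma Tq_explicit:
  "Tq q j g x = (q - 1) * ((x j * g x - x (Suc j) * g (x \<circ> str j)) / (x j - x (Suc j))) + g (x \<circ> str j)"
  by (simp add: Tq_def ddiff_def sact_def swap_pt_str) (simp add: str_def)

text \<open>Separating the weights of \<open>g x\<close> and of the swapped value lets products of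
  operators be compared coefficient by coefficient; the Hecke relations and the coset expansion
  start from this form.\<close>

lemma Tq_weights:
  assumes "x j \<noteq> x (Suc j)"
  shows "Tq q j g x = (q - 1) * x j / (x j - x (Suc j)) * g x
    + (x j - q * x (Suc j)) / (x j - x (Suc j)) * g (x \<circ> str j)"
proof -
  have "x j - x (Suc j) \<noteq> 0" using assms by simp
  then show ?thesis unfolding Tq_explicit by (simp add: divide_simps) (simp add: algebra_simps)
qed

lemma T_word_Nil [simp]: "T_word q [] g = g"
  and T_word_Cons [simp]: "T_word q (j # js) g = Tq q j (T_word q js g)"
  and T_word_append: "T_word q (js @ ks) g = T_word q js (T_word q ks g)"
  by (simp_all add: T_word_def)

lemma perm_of_word_Nil [simp]: "perm_of_word [] = id"
  and perm_of_word_Cons [simp]: "perm_of_word (j # js) = str j \<circ> perm_of_word js"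
  by (simp_all add: perm_of_word_def)

lemma perm_of_word_append: "perm_of_word (js @ ks) = perm_of_word js \<circ> perm_of_word ks"
  by (induction js) (auto simp: fun_eq_iff)

lemma perm_of_word_permutes: "is_word n js \<Longrightarrow> perm_of_word js permutes {1..n}"
proof (induction js)
  case Nil
  then show ?case using permutes_id[of "{1..n}"] by (simp add: id_def)
next
  case (Cons j js)
  then have "perm_of_word js permutes {1..n}" "str j permutes {1..n}"
    by (auto simp: is_word_def intro!: str_permutes[unfolded One_nat_def])
  then show ?case unfolding perm_of_word_Cons by (intro permutes_compose)
qed

lemma Tq_sum: "Tq q j (\<lambda>y. \<Sum>a\<in>I. g a y) x = (\<Sum>a\<in>I. Tq q j (g a) x)"
  unfolding Tq_explicit
  by (simp add: sum.distrib sum_distrib_left sum_subtractf flip: sum_divide_distrib)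
    (simp add: algebra_simps sum_distrib_left flip: sum_subtractf)

lemma T_word_sum: "T_word q js (\<lambda>y. \<Sum>a\<in>I. g a y) x = (\<Sum>a\<in>I. T_word q js (g a) x)"
proof (induction js arbitrary: x)
  case (Cons j js)
  have "T_word q js (\<lambda>y. \<Sum>a\<in>I. g a y) = (\<lambda>y. \<Sum>a\<in>I. T_word q js (g a) y)"
    using Cons by (intro ext)
  then show ?case by (simp add: Tq_sum)
qed simp

section \<open>Stability of generic points under permutations\<close>

lemma generic_neq: "generic q n x \<Longrightarrow> i \<in> {1..n} \<Longrightarrow> j \<in> {1..n} \<Longrightarrow> i \<noteq> j \<Longrightarrow> x i \<noteq> x j"
  and generic_q_neq: "generic q n x \<Longrightarrow> i \<in> {1..n} \<Longrightarrow> j \<in> {1..n} \<Longrightarrow> i \<noteq> j \<Longrightarrow> q * x i \<noteq> x j"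
  by (auto simp: generic_def)

lemma generic_comp:
  assumes "generic q n x" "w permutes {1..n}"
  shows "generic q n (x \<circ> w)"
  unfolding generic_def o_def
proof (intro ballI impI)
  fix i j assume ij: "i \<in> {1..n}" "j \<in> {1..n}" "i \<noteq> j"
  have "w i \<in> {1..n}" "w j \<in> {1..n}" "w i \<noteq> w j"
    using ij permutes_in_image[OF assms(2)] permutes_inj[OF assms(2)] by (auto simp: inj_eq)
  then show "x (w i) \<noteq> x (w j) \<and> q * x (w i) \<noteq> x (w j)"
    using assms(1) by (auto simp: generic_def)
qed

lemma generic_mono: "generic q n x \<Longrightarrow> m \<le> n \<Longrightarrow> generic q m x"
  by (auto simp: generic_def)

lemma Tq_cong:
  assumes "\<And>y. generic q n y \<Longrightarrow> g y = h y" "generic q n x" "j \<in> {1..<n}"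
  shows "Tq q j g x = Tq q j h x"
  using assms generic_comp[OF assms(2) str_permutes[OF assms(3)]] by (simp add: Tq_explicit)

lemma T_word_cong:
  assumes "\<And>y. generic q n y \<Longrightarrow> g y = h y" "generic q n x" "is_word n js"
  shows "T_word q js g x = T_word q js h x"
  using assms(2,3)
proof (induction js arbitrary: x)
  case (Cons j js)
  then show ?case by (auto simp: is_word_def intro!: Tq_cong[where n = n])
qed (use assms(1) in auto)

section \<open>Commutation and braid relations at generic points\<close>

lemma Tq_commute:
  assumes "j + 2 \<le> k" "k < n" "1 \<le> j" "generic q n x"
  shows "Tq q j (Tq q k g) x = Tq q k (Tq q j g) x"
proof -
  have d: "x j \<noteq> x (Suc j)" "x k \<noteq> x (Suc k)"
    using assms generic_neq[OF assms(4)] by auto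
  have s: "str j k = k" "str j (Suc k) = Suc k" "str k j = j" "str k (Suc j) = Suc j"
    using assms by (auto simp: str_def)
  define al be where "al = (\<lambda>u v. (q - 1) * u / (u - v))" and "be = (\<lambda>u v. (u - q * v) / (u - v))"
  have T: "Tq q i h y = al (y i) (y (Suc i)) * h y + be (y i) (y (Suc i)) * h (y \<circ> str i)"
    if "y i \<noteq> y (Suc i)" for i h y
    using Tq_weights[of y i q h] that by (simp add: al_def be_def)
  have "x \<circ> str j \<circ> str k = x \<circ> str k \<circ> str j"
    using assms by (auto simp: str_def fun_eq_iff)
  then show ?thesis using d by (simp add: T s algebra_simps)
qed

text \<open>Both sides expand over the six permutations of three adjacent variables. The
  coefficients at the permutations of length at least 2 agree at once; those at the identity and at
  the two swaps agree by the rational identities \<open>e1\<close>, \<open>e2\<close>,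
  \<open>e3\<close>.\<close>

lemma Tq_braid:
  assumes "Suc j < n" "1 \<le> j" "generic q n x"
  shows "Tq q j (Tq q (Suc j) (Tq q j g)) x = Tq q (Suc j) (Tq q j (Tq q (Suc j) g)) x"
proof -
  define a b c where "a = x j" and "b = x (Suc j)" and "c = x (Suc (Suc j))"
  note abc = a_def[symmetric] b_def[symmetric] c_def[symmetric]
  have d: "a \<noteq> b" "b \<noteq> c" "a \<noteq> c"
    using assms generic_neq[OF assms(3)] by (auto simp: a_def b_def c_def)
  define al be where "al = (\<lambda>u v. (q - 1) * u / (u - v))" and "be = (\<lambda>u v. (u - q * v) / (u - v))"
  let ?s = "str j" and ?t = "str (Suc j)"
  have T: "Tq q i h y = al (y i) (y (Suc i)) * h y + be (y i) (y (Suc i)) * h (y \<circ> str i)"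
    if "y i \<noteq> y (Suc i)" for i h y
    using Tq_weights[of y i q h] that by (simp add: al_def be_def)
  have s: "?s j = Suc j" "?s (Suc j) = j" "?s (Suc (Suc j)) = Suc (Suc j)"
      "?t (Suc j) = Suc (Suc j)" "?t (Suc (Suc j)) = Suc j" "?t j = j"
    by (auto simp: str_def)
  have p: "x \<circ> ?s \<circ> ?t \<circ> ?s = x \<circ> ?t \<circ> ?s \<circ> ?t"  "x \<circ> ?s \<circ> ?s = x" "x \<circ> ?t \<circ> ?t = x"
    by (auto simp: str_def fun_eq_iff)
  have e1: "al a b * al b c * al a b + be a b * al a c * be b a
      = al b c * al a b * al b c + be b c * al a c * be c b"
    unfolding al_def be_def using d by (simp add: divide_simps) (simp add: algebra_simps)
  have e2: "al a b * al b c * be a b + be a b * al a c * al b a = al b c * be a b * al a c"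
    unfolding al_def be_def using d by (simp add: divide_simps) (simp add: algebra_simps)
  have e3: "al a b * be b c * al a c = al b c * al a b * be b c + be b c * al a c * al c b"
    unfolding al_def be_def using d by (simp add: divide_simps) (simp add: algebra_simps)
  have "Tq q j (Tq q (Suc j) (Tq q j g)) x =
      (al a b * al b c * al a b + be a b * al a c * be b a) * g x
      + (al a b * al b c * be a b + be a b * al a c * al b a) * g (x \<circ> ?s)
      + (al a b * be b c * al a c) * g (x \<circ> ?t)
      + (be a b * be a c * al b c) * g (x \<circ> ?s \<circ> ?t)
      + (al a b * be b c * be a c) * g (x \<circ> ?t \<circ> ?s)
      + (be a b * be a c * be b c) * g (x \<circ> ?t \<circ> ?s \<circ> ?t)"
    using d d[symmetric] by (simp add: T s abc p) (simp add: algebra_simps)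
  moreover have "Tq q (Suc j) (Tq q j (Tq q (Suc j) g)) x =
      (al b c * al a b * al b c + be b c * al a c * be c b) * g x
      + (al b c * be a b * al a c) * g (x \<circ> ?s)
      + (al b c * al a b * be b c + be b c * al a c * al c b) * g (x \<circ> ?t)
      + (be a b * be a c * al b c) * g (x \<circ> ?s \<circ> ?t)
      + (al a b * be b c * be a c) * g (x \<circ> ?t \<circ> ?s)
      + (be a b * be a c * be b c) * g (x \<circ> ?t \<circ> ?s \<circ> ?t)"
    using d d[symmetric] by (simp add: T s abc p) (simp add: algebra_simps)
  ultimately show ?thesis by (simp only: e1 e2 e3)
qed

section \<open>Independence of the reduced word\<close>

text \<open>Operators are compared only at generic points, where no denominator vanishes; the
  permutation is carried along so that rewriting a word keeps the element it represents.\<close>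

definition word_eq :: "'k::field \<Rightarrow> nat \<Rightarrow> nat list \<Rightarrow> nat list \<Rightarrow> bool" where
  "word_eq q n js ks \<longleftrightarrow> perm_of_word js = perm_of_word ks \<and>
     (\<forall>g x. generic q n x \<longrightarrow> T_word q js g x = T_word q ks g x)"

lemma word_eq_refl: "word_eq q n js js"
  by (simp add: word_eq_def)

lemma word_eq_sym: "word_eq q n js ks \<Longrightarrow> word_eq q n ks js"
  by (simp add: word_eq_def)

lemma word_eq_trans [trans]: "word_eq q n js ks \<Longrightarrow> word_eq q n ks ls \<Longrightarrow> word_eq q n js ls"
  by (simp add: word_eq_def)

lemma word_eq_append:
  assumes "word_eq q n js ks" "is_word n is"
  shows "word_eq q n (is @ js @ ls) (is @ ks @ ls)"
  unfolding word_eq_def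
proof (intro conjI allI impI)
  show "perm_of_word (is @ js @ ls) = perm_of_word (is @ ks @ ls)"
    using assms(1) by (simp add: word_eq_def perm_of_word_append)
  fix g x assume "generic q n x"
  then show "T_word q (is @ js @ ls) g x = T_word q (is @ ks @ ls) g x"
    unfolding T_word_append
    by (rule T_word_cong[where n = n, rotated]) (use assms in \<open>auto simp: word_eq_def\<close>)
qed

lemma word_eq_commute:
  assumes "j + 2 \<le> k" "k < n" "1 \<le> j"
  shows "word_eq q n [j, k] [k, j]"
  using assms Tq_commute[OF assms]
  by (auto simp: word_eq_def str_def fun_eq_iff)

lemma word_eq_braid:
  assumes "Suc j < n" "1 \<le> j"
  shows "word_eq q n [j, Suc j, j] [Suc j, j, Suc j]"
  using assms Tq_braid[OF assms]
  by (auto simp: word_eq_def str_def fun_eq_iff)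

section \<open>Moving letters through blocks; normal words\<close>

lemma word_eq_pass_below:
  assumes "1 \<le> j" "j + 2 \<le> k" "m \<le> n"
  shows "word_eq q n (j # [k..<m]) ([k..<m] @ [j])"
  using assms
proof (induction "m - k" arbitrary: k)
  case 0
  then show ?case by (simp add: word_eq_refl)
next
  case (Suc d)
  then have u: "[k..<m] = k # [Suc k..<m]" and "d = m - Suc k" "k < m" by (auto simp: upt_conv_Cons)
  have "word_eq q n ([] @ [j, k] @ [Suc k..<m]) ([] @ [k, j] @ [Suc k..<m])"
    using Suc \<open>k < m\<close> by (intro word_eq_append word_eq_commute) (auto simp: is_word_def)
  moreover have "word_eq q n ([k] @ (j # [Suc k..<m]) @ []) ([k] @ ([Suc k..<m] @ [j]) @ [])"
    using Suc \<open>k < m\<close> by (intro word_eq_append Suc.hyps(1)) (auto simp: is_word_def)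
  ultimately show ?case
    unfolding u by (auto intro: word_eq_trans)
qed

text \<open>The letter commutes past \<open>k, ..., j - 1\<close>, the braid relation at
  \<open>j, Suc j\<close> lowers it by one, and the new letter \<open>j\<close> commutes with the
  rest of the block.\<close>

lemma word_eq_pass_within:
  assumes "1 \<le> k" "k \<le> j" "Suc j < m" "m \<le> n"
  shows "word_eq q n (Suc j # [k..<m]) ([k..<m] @ [j])"
  using assms
proof (induction "j - k" arbitrary: k)
  case 0
  then have u: "[k..<m] = [j, Suc j] @ [Suc (Suc j)..<m]" by (auto simp: upt_conv_Cons)
  have "word_eq q n ([] @ [Suc j, j, Suc j] @ [Suc (Suc j)..<m]) ([] @ [j, Suc j, j] @ [Suc (Suc j)..<m])"
    using 0 by (intro word_eq_append word_eq_sym[OF word_eq_braid]) (auto simp: is_word_def)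
  moreover have "word_eq q n ([j, Suc j] @ (j # [Suc (Suc j)..<m]) @ [])
      ([j, Suc j] @ ([Suc (Suc j)..<m] @ [j]) @ [])"
    using 0 by (intro word_eq_append word_eq_pass_below) (auto simp: is_word_def)
  ultimately show ?case
    unfolding u by (auto intro: word_eq_trans)
next
  case (Suc d)
  then have u: "[k..<m] = k # [Suc k..<m]" by (auto simp: upt_conv_Cons)
  have "word_eq q n ([] @ [Suc j, k] @ [Suc k..<m]) ([] @ [k, Suc j] @ [Suc k..<m])"
    using Suc by (intro word_eq_append word_eq_sym[OF word_eq_commute]) (auto simp: is_word_def)
  moreover have "word_eq q n ([k] @ (Suc j # [Suc k..<m]) @ []) ([k] @ ([Suc k..<m] @ [j]) @ [])"
    using Suc by (intro word_eq_append Suc.hyps(1)) (auto simp: is_word_def)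
  ultimately show ?case
    unfolding u by (auto intro: word_eq_trans)
qed

text \<open>The block \<^term>\<open>[k..<Suc n]\<close> is the minimal left coset representative sending
  \<^term>\<open>Suc n\<close> to \<^term>\<open>k\<close>.\<close>

fun normal_words :: "nat \<Rightarrow> nat list set" where
  "normal_words 0 = {[]}"
| "normal_words (Suc n) = (\<lambda>(k, js). [k..<Suc n] @ js) ` ({1..Suc n} \<times> normal_words n)"

lemma normal_words_is_word: "js \<in> normal_words n \<Longrightarrow> is_word n js"
proof (induction n arbitrary: js)
  case (Suc n)
  then obtain k ks where "js = [k..<Suc n] @ ks" "1 \<le> k" "ks \<in> normal_words n" by auto
  with Suc.IH[of ks] show ?case by (auto simp: is_word_def)
qed (simp add: is_word_def)

lemma perm_of_word_upt: "k \<le> m \<Longrightarrow> perm_of_word [k..<m] m = k"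
proof (induction "m - k" arbitrary: k)
  case (Suc d)
  then have "perm_of_word [Suc k..<m] m = Suc k" by auto
  then show ?case using Suc by (simp add: upt_conv_Cons str_def)
qed simp

lemma perm_of_word_fixes: "is_word n js \<Longrightarrow> perm_of_word js (Suc n) = Suc n"
  using permutes_not_in[OF perm_of_word_permutes] by fastforce

lemma perm_of_word_normal_last:
  assumes "js \<in> normal_words n" "k \<le> Suc n"
  shows "perm_of_word ([k..<Suc n] @ js) (Suc n) = k"
  using perm_of_word_fixes[OF normal_words_is_word[OF assms(1)]] perm_of_word_upt[OF assms(2)]
  by (simp add: perm_of_word_append del: upt_Suc)

lemma inj_perm_of_word: "inj (perm_of_word js)"
proof (induction js)
  case (Cons j js)
  have "inj (str j)" unfolding str_transpose by simp
  with Cons show ?case unfolding perm_of_word_Cons by (intro inj_compose)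
qed simp

text \<open>The image of \<open>Suc n\<close> reveals \<open>k\<close>, and cancelling the common
  block leaves shorter normal words.\<close>

lemma normal_words_inj:
  "js \<in> normal_words n \<Longrightarrow> ks \<in> normal_words n \<Longrightarrow> perm_of_word js = perm_of_word ks \<Longrightarrow> js = ks"
proof (induction n arbitrary: js ks)
  case (Suc n)
  obtain k js' where js: "js = [k..<Suc n] @ js'" "k \<le> Suc n" "js' \<in> normal_words n"
    using Suc.prems(1) by auto
  obtain l ks' where ks: "ks = [l..<Suc n] @ ks'" "l \<le> Suc n" "ks' \<in> normal_words n"
    using Suc.prems(2) by auto
  have "k = l"
    using perm_of_word_normal_last[OF js(3,2)] perm_of_word_normal_last[OF ks(3,2)] Suc.prems(3)
    unfolding js(1) ks(1) by metis
  moreover have "perm_of_word js' = perm_of_word ks'"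
  proof
    fix i
    have "perm_of_word [k..<Suc n] (perm_of_word js' i) = perm_of_word [k..<Suc n] (perm_of_word ks' i)"
      using fun_cong[OF Suc.prems(3), of i] unfolding js(1) ks(1) \<open>k = l\<close> perm_of_word_append by simp
    then show "perm_of_word js' i = perm_of_word ks' i"
      using inj_perm_of_word by (auto simp: inj_def)
  qed
  ultimately show ?case using Suc.IH js ks by blast
qed simp

lemma normal_words_split_inj: "inj_on (\<lambda>(k, js). [k..<Suc n] @ js) ({1..Suc n} \<times> normal_words n)"
proof (rule inj_onI, clarify)
  fix k js l ks
  assume *: "k \<in> {1..Suc n}" "l \<in> {1..Suc n}" "js \<in> normal_words n" "ks \<in> normal_words n"
    "[k..<Suc n] @ js = [l..<Suc n] @ ks"
  have "k = l"
    using perm_of_word_normal_last[of js n k] perm_of_word_normal_last[of ks n l] * by auto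
  with * show "k = l \<and> js = ks" by simp
qed

lemma card_normal_words: "card (normal_words n) = fact n"
proof (induction n)
  case (Suc n)
  then show ?case
    using card_image[OF normal_words_split_inj[of n]]
    by (simp add: card_cartesian_product del: upt_Suc)
qed simp

lemma bij_normal_words: "bij_betw perm_of_word (normal_words n) {w. w permutes {1..n}}"
proof -
  have inj: "inj_on perm_of_word (normal_words n)"
    by (rule inj_onI) (rule normal_words_inj)
  have "perm_of_word ` normal_words n \<subseteq> {w. w permutes {1..n}}"
    using perm_of_word_permutes normal_words_is_word by blast
  moreover have "card (perm_of_word ` normal_words n) = card {w. w permutes {1..n}}"
    using card_image[OF inj] by (simp add: card_normal_words card_permutations[of "{1..n}" n, simplified])
  ultimately have "perm_of_word ` normal_words n = {w. w permutes {1..n}}"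
    by (intro card_subset_eq) (auto simp: finite_permutations)
  with inj show ?thesis by (simp add: bij_betw_def)
qed

text \<open>A letter put before a normal word travels through the first block into the tail,
  prolongs the block, or cancels its first letter. An operator identity is claimed only when the
  length grows, since a drop in length shows that \<open>j # js\<close> was not reduced. The bound
  \<open>n\<close> stays fixed while the induction lowers \<open>m\<close>.\<close>

lemma normal_words_Cons:
  assumes "js \<in> normal_words m" "j \<in> {1..<m}" "m \<le> n"
  shows "\<exists>ks\<in>normal_words m. perm_of_word ks = perm_of_word (j # js) \<and>
    (length ks = Suc (length js) \<and> word_eq q n (j # js) ks \<or> length ks < length js)"
  using assms
proof (induction m arbitrary: j js)
  case (Suc m)
  obtain k js' where js: "js = [k..<Suc m] @ js'" and k: "1 \<le> k" "k \<le> Suc m"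
    and js': "js' \<in> normal_words m"
    using Suc.prems(1) by auto
  have wu: "is_word n [k..<Suc m]" using k Suc.prems(3) by (auto simp: is_word_def)
  have in_normal: "[l..<Suc m] @ ks \<in> normal_words (Suc m)"
    if "l \<in> {1..Suc m}" "ks \<in> normal_words m" for l ks
    using that by (auto simp del: upt_Suc)
  \<comment> \<open>Shared by the two cases in which the letter leaves the block as
    \<open>i\<close>: the induction hypothesis absorbs \<open>i\<close> into the tail
    \<open>js'\<close>.\<close>
  have pass: ?case if le: "i \<in> {1..<m}" and eq: "word_eq q n (j # [k..<Suc m]) ([k..<Suc m] @ [i])" for i
  proof -
    obtain ks where ks: "ks \<in> normal_words m" "perm_of_word ks = perm_of_word (i # js')"
      "length ks = Suc (length js') \<and> word_eq q n (i # js') ks \<or> length ks < length js'"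
      using Suc.IH[OF js' le] Suc.prems(3) Suc_leD by blast
    have e1: "word_eq q n (j # js) ([k..<Suc m] @ i # js')"
      using word_eq_append[OF eq, of "[]" js'] unfolding js by (simp add: is_word_def del: upt_Suc)
    have e2: "word_eq q n ([k..<Suc m] @ i # js') ([k..<Suc m] @ ks)" if "word_eq q n (i # js') ks"
      using word_eq_append[OF that wu, of "[]"] by simp
    show ?thesis
    proof (rule bexI[OF _ in_normal[OF _ ks(1)]])
      show "k \<in> {1..Suc m}" using k by simp
      have "perm_of_word ([k..<Suc m] @ ks) = perm_of_word (j # js)"
        using e1 ks(2) by (simp add: word_eq_def perm_of_word_append del: upt_Suc)
      then show "perm_of_word ([k..<Suc m] @ ks) = perm_of_word (j # js) \<and>
          (length ([k..<Suc m] @ ks) = Suc (length js) \<and> word_eq q n (j # js) ([k..<Suc m] @ ks) \<or>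
           length ([k..<Suc m] @ ks) < length js)"
        using ks(3) word_eq_trans[OF e1 e2] by (auto simp: js simp del: upt_Suc)
    qed
  qed
  consider "j + 2 \<le> k" | "k = Suc j" | "j = k" | "k < j" by linarith
  then show ?case
  proof cases
    case 1
    then show ?thesis using Suc.prems k by (intro pass[of j] word_eq_pass_below) auto
  next
    case 2
    then have "j # js = [j..<Suc m] @ js'" using Suc.prems(2) by (simp add: js upt_conv_Cons del: upt_Suc)
    moreover have "[j..<Suc m] @ js' \<in> normal_words (Suc m)"
      using Suc.prems(2) by (intro in_normal js') auto
    ultimately show ?thesis using word_eq_refl by (metis length_Cons)
  next
    case 3
    then have j: "[k..<Suc m] = j # [Suc j..<Suc m]" using Suc.prems(2) by (simp add: upt_conv_Cons del: upt_Suc)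
    have "str j \<circ> (str j \<circ> p) = p" for p :: "nat \<Rightarrow> nat"
      by (auto simp: str_def fun_eq_iff)
    then have "perm_of_word ([Suc j..<Suc m] @ js') = perm_of_word (j # js)"
      unfolding js j by simp
    moreover have "[Suc j..<Suc m] @ js' \<in> normal_words (Suc m)"
      using Suc.prems(2) by (intro in_normal js') auto
    ultimately show ?thesis unfolding js j by (intro bexI[of _ "[Suc j..<Suc m] @ js'"]) auto
  next
    case 4
    then obtain i where "j = Suc i" by (cases j) auto
    then show ?thesis using 4 Suc.prems k
      by (intro pass[of i]) (auto intro!: word_eq_pass_within simp del: upt_Suc)
  qed
qed simp

text \<open>Letters are absorbed one at a time, starting from the right. Equal lengths at the end
  force every absorption to have lengthened the word, and then the operator identities
  compose.\<close>

lemma word_normal_form: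
  assumes "is_word n js"
  shows "\<exists>ks\<in>normal_words n. perm_of_word ks = perm_of_word js \<and> length ks \<le> length js \<and>
    (length ks = length js \<longrightarrow> word_eq q n js ks)"
  using assms
proof (induction js)
  case Nil
  have "[] \<in> normal_words n" 
  proof (induction n)
    case (Suc n)
    have "[] = (\<lambda>(k, js). [k..<Suc n] @ js) (Suc n, [])" by simp
    then show ?case using Suc by (simp only: normal_words.simps) (rule image_eqI[of _ _ "(Suc n, [])"], auto)
  qed simp
  then show ?case by (auto intro: word_eq_refl)
next
  case (Cons j js)
  then have j: "j \<in> {1..<n}" and "is_word n js" by (auto simp: is_word_def)
  then obtain ks where ks: "ks \<in> normal_words n" "perm_of_word ks = perm_of_word js"
    "length ks \<le> length js" "length ks = length js \<Longrightarrow> word_eq q n js ks"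
    using Cons.IH by auto
  obtain ls where ls: "ls \<in> normal_words n" "perm_of_word ls = perm_of_word (j # ks)"
    "length ls = Suc (length ks) \<and> word_eq q n (j # ks) ls \<or> length ls < length ks"
    using normal_words_Cons[OF ks(1) j order_refl] by blast
  have "word_eq q n (j # js) ls" if "length ls = length (j # js)"
  proof -
    have "length ks = length js" "word_eq q n (j # ks) ls" using that ls(3) ks(3) by auto
    moreover have "word_eq q n (j # js) (j # ks)"
      using word_eq_append[OF ks(4), of "[j]" "[]"] calculation(1) j by (simp add: is_word_def)
    ultimately show ?thesis by (blast intro: word_eq_trans)
  qed
  with ks ls show ?case by (intro bexI[OF _ ls(1)]) auto
qed

text \<open>The reduced word chosen in \<open>T_perm\<close> is as long as its normal form by
  minimality, so both give the same operator at generic points. Canonical words thereby replace the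
  arbitrary choice.\<close>

lemma T_perm_normal:
  assumes "ks \<in> normal_words n" "generic q n x"
  shows "T_perm q n (perm_of_word ks) g x = T_word q ks g x"
proof -
  let ?w = "perm_of_word ks"
  define js where "js = (SOME js. reduced_word n ?w js)"
  have "\<exists>js. is_word n js \<and> perm_of_word js = ?w"
    using normal_words_is_word[OF assms(1)] by auto
  then have "\<exists>js. reduced_word n ?w js" 
    using ex_has_least_nat[of "\<lambda>js. is_word n js \<and> perm_of_word js = ?w" _ length]
    unfolding reduced_word_def by blast
  then have "reduced_word n ?w js" unfolding js_def by (rule someI_ex)
  then have js: "is_word n js" "perm_of_word js = ?w"
    "\<And>ls. is_word n ls \<Longrightarrow> perm_of_word ls = ?w \<Longrightarrow> length js \<le> length ls"
    by (auto simp: reduced_word_def)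
  obtain ls where ls: "ls \<in> normal_words n" "perm_of_word ls = perm_of_word js"
    "length ls \<le> length js" "length ls = length js \<Longrightarrow> word_eq q n js ls"
    using word_normal_form[OF js(1)] by blast
  have "ls = ks" using normal_words_inj[OF ls(1) assms(1)] ls(2) js(2) by simp
  moreover have "length js \<le> length ls"
    using js(3)[OF normal_words_is_word[OF ls(1)]] ls(2) js(2) by simp
  ultimately have "word_eq q n js ks" using ls by simp
  then show ?thesis using assms(2) by (simp add: T_perm_def js_def word_eq_def)
qed

lemma sum_T_perm:
  assumes "generic q n x"
  shows "(\<Sum>w\<in>{w. w permutes {1..n}}. T_perm q n w g x) = (\<Sum>js\<in>normal_words n. T_word q js g x)"
  using sum.reindex_bij_betw[OF bij_normal_words, of "\<lambda>w. T_perm q n w g x" n, symmetric]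
    T_perm_normal[OF _ assms] by simp

lemma sum_normal_words_Suc:
  "(\<Sum>js\<in>normal_words (Suc n). T_word q js g x) =
    (\<Sum>k=1..Suc n. T_word q [k..<Suc n] (\<lambda>y. \<Sum>js\<in>normal_words n. T_word q js g y) x)"
  unfolding normal_words.simps sum.reindex[OF normal_words_split_inj]
  by (simp add: sum.cartesian_product T_word_sum T_word_append split_def del: upt_Suc sum.cl_ivl_Suc)

section \<open>The symmetrizer as a sum over permutations\<close>

definition ratio :: "'k::field \<Rightarrow> 'k \<Rightarrow> 'k \<Rightarrow> 'k" where
  "ratio q a b = (q * a - b) / (a - b)"

text \<open>For \<open>m = 1\<close>, the weight of the coset carrying \<open>n\<close> to
  \<open>l\<close> in the sum of the Hecke operators; general \<open>m\<close> serves the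
  telescoping in \<open>sum_T_word_upt\<close>.\<close>

definition coset_kernel :: "'k::field \<Rightarrow> nat \<Rightarrow> nat \<Rightarrow> nat \<Rightarrow> (nat \<Rightarrow> 'k) \<Rightarrow> 'k" where
  "coset_kernel q m n l x = (\<Prod>i\<in>{m..n} - {l}. ratio q (x i) (x l))"

text \<open>A kernel of Hall-Littlewood type, through which the sum of all \<open>T_w\<close>
  becomes a plain sum over permutations.\<close>

definition symmetrizer_kernel :: "'k::field \<Rightarrow> nat \<Rightarrow> (nat \<Rightarrow> 'k) \<Rightarrow> 'k" where
  "symmetrizer_kernel q n x = (\<Prod>j=1..n. \<Prod>i=1..<j. ratio q (x i) (x j))"

section \<open>Expansion over cosets of the smaller symmetric group\<close>

lemma coset_kernel_Suc:
  assumes "m \<le> n" "m \<noteq> l"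
  shows "coset_kernel q m n l x = ratio q (x m) (x l) * coset_kernel q (Suc m) n l x"
proof -
  have "{m..n} - {l} = insert m ({Suc m..n} - {l})" using assms by auto
  then show ?thesis by (simp add: coset_kernel_def)
qed

lemma coset_kernel_same: "coset_kernel q m n m x = coset_kernel q (Suc m) n m x"
proof -
  have "{m..n} - {m} = {Suc m..n} - {m}" by auto
  then show ?thesis by (simp add: coset_kernel_def)
qed

text \<open>Downward induction on \<open>m\<close>, peeling off the leftmost operator. As
  \<open>G\<close> is symmetric in the first \<open>N - 1\<close> places, only the variable put in
  place \<open>N\<close> matters, hence one term for each \<open>l\<close>.\<close>

lemma T_word_upt_expand:
  assumes sym: "\<And>p y. p permutes {1..<N} \<Longrightarrow> G (y \<circ> p) = G y"
    and "generic q N x" "1 \<le> m" "m \<le> N"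
  shows "T_word q [m..<N] G x = coset_kernel q (Suc m) N m x * G (x \<circ> transpose m N)
    + (\<Sum>l=Suc m..N. (ratio q (x m) (x l) - 1) * coset_kernel q (Suc m) N l x * G (x \<circ> transpose l N))"
    (is "_ = ?E m x")
  using assms(2-4)
proof (induction "N - m" arbitrary: m x)
  case 0
  then show ?case by (simp add: coset_kernel_def)
next
  case (Suc d)
  then have m: "1 \<le> m" "m < N" by auto
  let ?s = "str m" and ?y = "x \<circ> str m"
  have gy: "generic q N ?y" using Suc.prems m by (intro generic_comp str_permutes) auto
  have IH: "T_word q [Suc m..<N] G z = ?E (Suc m) z" if "generic q N z" for z
    using that Suc.hyps(2) m by (intro Suc.hyps(1)) auto
  have s: "str m m = Suc m" "str m (Suc m) = m" "\<And>i. Suc (Suc m) \<le> i \<Longrightarrow> str m i = i"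
    by (auto simp: str_def)
  have neq: "x m \<noteq> x (Suc m)" using m by (intro generic_neq[OF Suc.prems(1)]) auto
  have sp: "str m permutes {1..<N}" if "Suc m < N"
    unfolding str_transpose using that m by (intro permutes_swap_id) auto
  let ?R = "{Suc (Suc m)..N}"
  have ky: "coset_kernel q (Suc (Suc m)) N l ?y = coset_kernel q (Suc (Suc m)) N (str m l) x"
    if "l \<ge> Suc m" for l
    unfolding coset_kernel_def
    by (intro prod.cong) (use that in \<open>auto simp: s str_def\<close>)
  \<comment> \<open>Moved to the right of the transposition, the swap permutes places below
    \<open>N\<close> and is absorbed by the symmetry of \<open>G\<close>.\<close>
  have Gl: "G (?y \<circ> transpose l N) = G (x \<circ> transpose l N)" if "l \<in> ?R" for l
  proof -
    have "?y \<circ> transpose l N = x \<circ> transpose l N \<circ> str m"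
      using that by (auto simp: fun_eq_iff str_def transpose_def)
    then show ?thesis using that sym[OF sp, of "x \<circ> transpose l N"] by simp
  qed
  have Gm: "G (?y \<circ> transpose (Suc m) N) = G (x \<circ> transpose m N)"
  proof (cases "Suc m = N")
    case True
    then show ?thesis by (simp add: str_transpose)
  next
    case False
    have "?y \<circ> transpose (Suc m) N = x \<circ> transpose m N \<circ> str m"
      using m False by (auto simp: fun_eq_iff str_def transpose_def)
    then show ?thesis using m False sym[OF sp, of "x \<circ> transpose m N"] by simp
  qed
  let ?a = "x m" and ?b = "x (Suc m)"
  let ?K = "\<lambda>l. coset_kernel q (Suc (Suc m)) N l x" and ?G = "\<lambda>l. G (x \<circ> transpose l N)"
  have E1: "?E (Suc m) ?y = ?K m * ?G m + (\<Sum>l\<in>?R. (ratio q ?a (x l) - 1) * ?K l * ?G l)"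
  proof (intro arg_cong2[where f = "(+)"] sum.cong refl)
    show "coset_kernel q (Suc (Suc m)) N (Suc m) ?y * G (?y \<circ> transpose (Suc m) N) = ?K m * ?G m"
      using ky[of "Suc m"] by (simp only: Gm s order_refl)
    fix l assume "l \<in> ?R"
    then show "(ratio q (?y (Suc m)) (?y l) - 1) * coset_kernel q (Suc (Suc m)) N l ?y * G (?y \<circ> transpose l N) =
        (ratio q ?a (x l) - 1) * ?K l * ?G l"
      using ky[of l] s(3)[of l] by (simp only: Gl s comp_apply atLeastAtMost_iff Suc_leD)
  qed
  have [simp]: "coset_kernel q (Suc m) N m x = ratio q ?b ?a * ?K m"
    "coset_kernel q (Suc m) N (Suc m) x = ?K (Suc m)"
    using m by (simp_all add: coset_kernel_Suc coset_kernel_same)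
  define P where "P = (\<Sum>l\<in>?R. (ratio q ?b (x l) - 1) * ?K l * ?G l)"
  define Q where "Q = (\<Sum>l\<in>?R. (ratio q ?a (x l) - 1) * ?K l * ?G l)"
  have R: "{Suc m..N} = insert (Suc m) ?R" using m by auto
  have "(\<Sum>l\<in>?R. (ratio q ?a (x l) - 1) * coset_kernel q (Suc m) N l x * ?G l) =
      (\<Sum>l\<in>?R. (ratio q ?a ?b - 1) * ((ratio q ?b (x l) - 1) * ?K l * ?G l)
        + ratio q ?b ?a * ((ratio q ?a (x l) - 1) * ?K l * ?G l))"
  proof (rule sum.cong[OF refl])
    fix l assume l: "l \<in> ?R"
    have "?a \<noteq> x l" "?b \<noteq> x l"
      using m l by (intro generic_neq[OF Suc.prems(1)]; auto)+
    \<comment> \<open>This three-point identity for \<open>ratio\<close> closes the induction: it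
      merges the contributions of \<open>x\<close> and of the swapped point to the term of
      \<open>l\<close>.\<close>
    with neq have "(ratio q ?a (x l) - 1) * ratio q ?b (x l) =
      (ratio q ?a ?b - 1) * (ratio q ?b (x l) - 1) + ratio q ?b ?a * (ratio q ?a (x l) - 1)"
      unfolding ratio_def by (simp add: divide_simps) (simp add: algebra_simps)
    moreover have "coset_kernel q (Suc m) N l x = ratio q ?b (x l) * ?K l"
      using l m by (intro coset_kernel_Suc) auto
    ultimately show "(ratio q ?a (x l) - 1) * coset_kernel q (Suc m) N l x * ?G l =
      (ratio q ?a ?b - 1) * ((ratio q ?b (x l) - 1) * ?K l * ?G l)
        + ratio q ?b ?a * ((ratio q ?a (x l) - 1) * ?K l * ?G l)"
      by (metis (no_types, lifting) distrib_right mult.assoc)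
  qed
  then have "(\<Sum>l\<in>?R. (ratio q ?a (x l) - 1) * coset_kernel q (Suc m) N l x * ?G l) =
      (ratio q ?a ?b - 1) * P + ratio q ?b ?a * Q"
    unfolding P_def Q_def by (simp only: sum.distrib sum_distrib_left)
  then have "?E m x = ratio q ?b ?a * ?K m * ?G m +
      ((ratio q ?a ?b - 1) * ?K (Suc m) * ?G (Suc m) + ((ratio q ?a ?b - 1) * P + ratio q ?b ?a * Q))"
    unfolding R by (subst sum.insert) auto
  moreover have "?E (Suc m) x = ?K (Suc m) * ?G (Suc m) + P" by (simp only: P_def)
  moreover have "?E (Suc m) ?y = ?K m * ?G m + Q" by (simp only: E1 Q_def)
  ultimately have "?E m x = (ratio q ?a ?b - 1) * ?E (Suc m) x + ratio q ?b ?a * ?E (Suc m) ?y"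
    by (simp only: algebra_simps)
  moreover have "T_word q [m..<N] G x = (ratio q ?a ?b - 1) * ?E (Suc m) x + ratio q ?b ?a * ?E (Suc m) ?y"
  proof -
    have "T_word q [m..<N] G x = Tq q m (T_word q [Suc m..<N] G) x"
      using m by (simp add: upt_conv_Cons)
    also have "\<dots> = (q - 1) * ?a / (?a - ?b) * ?E (Suc m) x + (?a - q * ?b) / (?a - ?b) * ?E (Suc m) ?y"
      unfolding Tq_weights[where x = x and j = m, OF neq] by (simp only: IH[OF Suc.prems(1)] IH[OF gy])
    also have "(q - 1) * ?a / (?a - ?b) = ratio q ?a ?b - 1"
      using neq by (simp add: ratio_def divide_simps) (simp add: algebra_simps)
    also have "(?a - q * ?b) / (?a - ?b) = ratio q ?b ?a"
      using neq by (simp add: ratio_def divide_simps) (simp add: algebra_simps)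
    finally show ?thesis .
  qed
  ultimately show ?case by (simp only:)
qed

text \<open>By \<open>coset_kernel_Suc\<close> the expansion for \<open>m\<close> equals
  \<open>V m - V (Suc m)\<close>, where \<open>V m\<close> uses the kernels starting at
  \<open>m\<close>; the sum telescopes to \<open>V 1\<close>.\<close>

lemma sum_T_word_upt:
  assumes sym: "\<And>p y. p permutes {1..<N} \<Longrightarrow> G (y \<circ> p) = G y"
    and "generic q N x" "1 \<le> N"
  shows "(\<Sum>m=1..N. T_word q [m..<N] G x) = (\<Sum>l=1..N. coset_kernel q 1 N l x * G (x \<circ> transpose l N))"
proof -
  define V where "V m = (\<Sum>l=m..N. coset_kernel q m N l x * G (x \<circ> transpose l N))" for m
  have "T_word q [m..<N] G x = V m - V (Suc m)" if m: "1 \<le> m" "m \<le> N" for m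
  proof -
    have "{m..N} = insert m {Suc m..N}" using m by auto
    then have "V m = coset_kernel q (Suc m) N m x * G (x \<circ> transpose m N)
      + (\<Sum>l=Suc m..N. coset_kernel q m N l x * G (x \<circ> transpose l N))"
      by (simp add: V_def coset_kernel_same)
    then show ?thesis
      using T_word_upt_expand[where G = G, OF sym assms(2) m] m
      by (simp add: V_def algebra_simps coset_kernel_Suc sum_subtractf)
  qed
  then have "(\<Sum>m=1..N. T_word q [m..<N] G x) = (\<Sum>m=1..N. V m - V (Suc m))"
    by simp
  also have "\<dots> = V 1 - V (Suc N)"
    using assms(3) sum_Suc_diff[of 1 "Suc N" "\<lambda>i. - V i"] by (simp add: sum_negf sum_subtractf algebra_simps)
  also have "V (Suc N) = 0" by (simp add: V_def)
  finally show ?thesis by (simp add: V_def)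
qed

lemma sum_permutes_comp_right:
  assumes "p permutes A"
  shows "(\<Sum>w\<in>{w. w permutes A}. F (w \<circ> p)) = (\<Sum>w\<in>{w. w permutes A}. F w)"
proof (rule sum.reindex_bij_witness[where i = "\<lambda>w. w \<circ> inv p" and j = "\<lambda>w. w \<circ> p"])
  fix w assume "w \<in> {w. w permutes A}"
  then show "w \<circ> p \<in> {w. w permutes A}" "w \<circ> inv p \<in> {w. w permutes A}"
    using assms by (auto intro: permutes_compose permutes_inv simp: permutes_compose[OF assms])
  show "w \<circ> p \<circ> inv p = w" "w \<circ> inv p \<circ> p = w"
    using permutes_inv_o[OF assms] by (simp_all add: o_assoc[symmetric])
qed auto

lemma sum_permutes_comp_left:
  assumes "p permutes A"
  shows "(\<Sum>w\<in>{w. w permutes A}. F (p \<circ> w)) = (\<Sum>w\<in>{w. w permutes A}. F w)"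
proof (rule sum.reindex_bij_witness[where i = "\<lambda>w. inv p \<circ> w" and j = "\<lambda>w. p \<circ> w"])
  fix w assume "w \<in> {w. w permutes A}"
  then show "p \<circ> w \<in> {w. w permutes A}" "inv p \<circ> w \<in> {w. w permutes A}"
    using assms permutes_inv[OF assms] by (auto intro: permutes_compose)
  show "inv p \<circ> (p \<circ> w) = w" "p \<circ> (inv p \<circ> w) = w"
    using permutes_inv_o[OF assms] by (simp_all add: o_assoc)
qed auto

text \<open>Induction along cosets: the inner sum \<open>G\<close> is symmetric by left translation,
  so the coset expansion applies, and \<open>coset_kernel\<close> supplies the kernel factors that
  involve the last place.\<close>

lemma sum_T_word_normal:
  assumes "generic q n x"
  shows "(\<Sum>js\<in>normal_words n. T_word q js h x) =
    (\<Sum>w\<in>{w. w permutes {1..n}}. h (x \<circ> w) * symmetrizer_kernel q n (x \<circ> w))"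
  using assms
proof (induction n arbitrary: x)
  case 0
  then show ?case by (simp add: symmetrizer_kernel_def)
next
  case (Suc n)
  define G where "G y = (\<Sum>w\<in>{w. w permutes {1..n}}. h (y \<circ> w) * symmetrizer_kernel q n (y \<circ> w))" for y
  have sym: "G (y \<circ> p) = G y" if "p permutes {1..<Suc n}" for p y
    unfolding G_def
    using sum_permutes_comp_left[of p "{1..n}" "\<lambda>w. h (y \<circ> w) * symmetrizer_kernel q n (y \<circ> w)"] that
    by (simp add: o_assoc atLeastLessThanSuc_atLeastAtMost)
  have "(\<Sum>js\<in>normal_words (Suc n). T_word q js h x) = (\<Sum>k=1..Suc n. T_word q [k..<Suc n] G x)"
    unfolding sum_normal_words_Suc
  proof (intro sum.cong[OF refl] T_word_cong[where n = "Suc n"])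
    fix y :: "nat \<Rightarrow> 'a"
    assume "generic q (Suc n) y"
    then show "(\<Sum>js\<in>normal_words n. T_word q js h y) = G y"
      unfolding G_def by (intro Suc.IH) (rule generic_mono, auto)
  qed (use Suc.prems in \<open>auto simp: is_word_def\<close>)
  also have "\<dots> = (\<Sum>l=1..Suc n. coset_kernel q 1 (Suc n) l x * G (x \<circ> transpose l (Suc n)))"
    by (rule sum_T_word_upt[OF sym Suc.prems]) auto
  also have "\<dots> = (\<Sum>l\<in>insert (Suc n) {1..n}. \<Sum>w\<in>{w. w permutes {1..n}}.
      h (x \<circ> (transpose (Suc n) l \<circ> w)) * symmetrizer_kernel q (Suc n) (x \<circ> (transpose (Suc n) l \<circ> w)))"
  proof (rule sum.cong)
    fix l assume "l \<in> insert (Suc n) {1..n}"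
    then have l: "l \<in> {1..Suc n}" by auto
    have "symmetrizer_kernel q (Suc n) (x \<circ> (transpose (Suc n) l \<circ> w)) =
      coset_kernel q 1 (Suc n) l x * symmetrizer_kernel q n (x \<circ> transpose l (Suc n) \<circ> w)"
      if w: "w permutes {1..n}" for w
    proof -
      let ?t = "transpose l (Suc n)"
      have wn: "w (Suc n) = Suc n" using w by (simp add: permutes_not_in)
      \<comment> \<open>First \<open>w\<close> and then the transposition only permute the factors,
        which run over all variables except \<open>x l\<close>.\<close>
      have "(\<Prod>i=1..<Suc n. ratio q (x (?t (w i))) (x l)) = (\<Prod>i\<in>{1..n}. ratio q (x (?t i)) (x l))"
        using prod.reindex_bij_betw[OF permutes_imp_bij[OF w], of "\<lambda>i. ratio q (x (?t i)) (x l)"]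
        by (simp add: atLeastLessThanSuc_atLeastAtMost)
      also have "\<dots> = coset_kernel q 1 (Suc n) l x"
        unfolding coset_kernel_def
        by (rule prod.reindex_bij_witness[where i = ?t and j = ?t])
          (use l in \<open>auto simp: transpose_def split: if_splits\<close>)
      finally show ?thesis
        by (simp add: symmetrizer_kernel_def wn transpose_commute mult.commute o_def)
    qed
    then show "coset_kernel q 1 (Suc n) l x * G (x \<circ> transpose l (Suc n)) = (\<Sum>w\<in>{w. w permutes {1..n}}.
      h (x \<circ> (transpose (Suc n) l \<circ> w)) * symmetrizer_kernel q (Suc n) (x \<circ> (transpose (Suc n) l \<circ> w)))"
      unfolding G_def sum_distrib_left
      by (intro sum.cong) (simp_all add: o_assoc transpose_commute[of "Suc n" l] mult_ac)
  qed auto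
  also have "\<dots> = (\<Sum>w\<in>{w. w permutes {1..Suc n}}. h (x \<circ> w) * symmetrizer_kernel q (Suc n) (x \<circ> w))"
    using sum_over_permutations_insert[of "{1..n}" "Suc n"
        "\<lambda>w. h (x \<circ> w) * symmetrizer_kernel q (Suc n) (x \<circ> w)", symmetric]
    by (simp add: atLeastAtMostSuc_conv)
  finally show ?case .
qed

section \<open>Vanishing in low degree\<close>

definition difference_product :: "nat \<Rightarrow> (nat \<Rightarrow> 'k::field) \<Rightarrow> 'k" where
  "difference_product n y = (\<Prod>(a, b)\<in>{(a, b). 1 \<le> a \<and> a < b \<and> b \<le> n}. y a - y b)"

text \<open>The pairs whose factors survive once the denominator of \<open>qDS\<close> has cancelled
  the adjacent ones; a general lower end \<open>l\<close> is used when the range is cut into two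
  groups.\<close>

definition far_pairs :: "nat \<Rightarrow> nat \<Rightarrow> (nat \<times> nat) set" where
  "far_pairs l m = {(a, b). l \<le> a \<and> a + 2 \<le> b \<and> b \<le> m}"

lemma finite_pairs: "finite {(a, b). 1 \<le> a \<and> a < b \<and> b \<le> (n::nat)}"
  by (rule finite_subset[of _ "{..n} \<times> {..n}"]) auto

lemma finite_far_pairs [simp]: "finite (far_pairs l m)"
  by (rule finite_subset[of _ "{..m} \<times> {..m}"]) (auto simp: far_pairs_def)

lemma card_far_pairs: "card (far_pairs l m) = (m - l) choose 2"
proof (induction m)
  case 0
  have "far_pairs l 0 = {}" by (auto simp: far_pairs_def)
  then show ?case by simp
next
  case (Suc m)
  have "far_pairs l (Suc m) = far_pairs l m \<union> (\<lambda>a. (a, Suc m)) ` {l..<m}"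
    by (auto simp: far_pairs_def le_Suc_eq)
  moreover have "card (far_pairs l m \<union> (\<lambda>a. (a, Suc m)) ` {l..<m}) = card (far_pairs l m) + (m - l)"
  proof (subst card_Un_disjoint)
    show "far_pairs l m \<inter> (\<lambda>a. (a, Suc m)) ` {l..<m} = {}" by (auto simp: far_pairs_def)
  qed (auto simp: card_image inj_on_def)
  ultimately show ?case using Suc
    by (cases "l \<le> m") (auto simp: Suc_diff_le numeral_2_eq_2)
qed

section \<open>Antisymmetry of the Vandermonde product\<close>

text \<open>Only the factor of \<open>(j, Suc j)\<close> changes sign; the other pairs are permuted
  among themselves.\<close>

lemma difference_product_str:
  assumes "j \<in> {1..<n}"
  shows "difference_product n (y \<circ> str j) = - difference_product n y"
proof -
  let ?P = "{(a, b). 1 \<le> a \<and> a < b \<and> b \<le> n}"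
  let ?Q = "?P - {(j, Suc j)}"
  have P: "?P = insert (j, Suc j) ?Q" using assms by auto
  have fin: "finite ?Q" using finite_pairs by auto
  have "(\<Prod>(a, b)\<in>?Q. y (str j a) - y (str j b)) = (\<Prod>(a, b)\<in>?Q. y a - y b)"
    by (rule prod.reindex_bij_witness[where i = "map_prod (str j) (str j)" and j = "map_prod (str j) (str j)"])
      (use assms in \<open>auto simp: str_def split: if_splits\<close>)
  then show ?thesis
    unfolding difference_product_def
    by (subst (1 2) P, subst (1 2) prod.insert[OF fin]) (auto simp: str_def split_def algebra_simps)
qed

lemma difference_product_word:
  "is_word n js \<Longrightarrow> difference_product n (y \<circ> perm_of_word js) = (-1) ^ length js * difference_product n y"
proof (induction js arbitrary: y)
  case (Cons j js)
  then show ?case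
    using difference_product_str[of j n y] Cons.IH[of "y \<circ> str j"]
    unfolding perm_of_word_Cons o_assoc by (auto simp: is_word_def simp del: comp_apply)
qed simp

lemma sign_word:
  assumes "is_word n js"
  shows "sign (perm_of_word js) = (-1) ^ length js"
  using assms
proof (induction js)
  case (Cons j js)
  have "permutation (perm_of_word js)"
    using Cons.prems perm_of_word_permutes[of n js] permutation_permutes
    by (auto simp: is_word_def)
  then show ?case
    using Cons by (simp add: sign_compose str_transpose sign_swap_id permutation_swap_id is_word_def
        del: comp_apply)
qed (simp add: id_def)

text \<open>A transposition is odd, so a word for it has odd length, and each letter contributes one
  sign change.\<close>

lemma difference_product_transpose:
  assumes "a \<in> {1..n}" "b \<in> {1..n}" "a \<noteq> b"
  shows "difference_product n (y \<circ> transpose a b) = - difference_product n y"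
proof -
  have "transpose a b \<in> {w. w permutes {1..n}}" using assms by (simp add: permutes_swap_id)
  then obtain js where js: "js \<in> normal_words n" "transpose a b = perm_of_word js"
    using bij_normal_words[of n] by (auto simp: bij_betw_def)
  have w: "is_word n js" using js(1) by (rule normal_words_is_word)
  have "(-1) ^ length js = (-1 :: int)"
    using sign_word[OF w] assms(3) by (simp add: js(2)[symmetric] sign_swap_id)
  then have "odd (length js)" by (cases "even (length js)") auto
  then show ?thesis using difference_product_word[OF w, of y] by (simp add: js(2))
qed

text \<open>Among all pairs, the adjacent numerators of \<open>symmetrizer_kernel\<close> cancel the
  denominator of \<open>qDS\<close>, which is nonzero at generic points.\<close>

lemma qDS_explicit:
  assumes "generic q n x"
  shows "qDS q n f x = (\<Sum>w\<in>{w. w permutes {1..n}}.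
    f (x \<circ> w) * (\<Prod>(a, b)\<in>far_pairs 1 n. q * x (w a) - x (w b)) / difference_product n (x \<circ> w))"
proof -
  let ?P = "{(a, b). 1 \<le> a \<and> a < b \<and> b \<le> n}"
  let ?adj = "(\<lambda>j. (j, Suc j)) ` {1..<n}"
  have P: "?P = ?adj \<union> far_pairs 1 n" by (auto simp: far_pairs_def image_iff)
  have disj: "?adj \<inter> far_pairs 1 n = {}" by (auto simp: far_pairs_def)
  have "symmetrizer_kernel q n y / (\<Prod>j=1..<n. q * y j - y (Suc j)) =
    (\<Prod>(a, b)\<in>far_pairs 1 n. q * y a - y b) / difference_product n y" if "generic q n y" for y
  proof -
    have "symmetrizer_kernel q n y = (\<Prod>(j, i)\<in>Sigma {1..n} (\<lambda>j. {1..<j}). ratio q (y i) (y j))"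
      unfolding symmetrizer_kernel_def by (rule prod.Sigma) auto
    also have "\<dots> = (\<Prod>(a, b)\<in>?P. ratio q (y a) (y b))"
      by (rule prod.reindex_bij_witness[where i = prod.swap and j = prod.swap]) auto
    also have "\<dots> = (\<Prod>(a, b)\<in>?P. q * y a - y b) / difference_product n y"
      by (simp add: ratio_def difference_product_def prod_dividef[symmetric] split_def)
    also have "(\<Prod>(a, b)\<in>?P. q * y a - y b) =
      (\<Prod>j=1..<n. q * y j - y (Suc j)) * (\<Prod>(a, b)\<in>far_pairs 1 n. q * y a - y b)"
      unfolding P by (subst prod.union_disjoint[OF _ _ disj]) (auto simp: prod.reindex inj_on_def)
    finally have "symmetrizer_kernel q n y = (\<Prod>j=1..<n. q * y j - y (Suc j)) *
      (\<Prod>(a, b)\<in>far_pairs 1 n. q * y a - y b) / difference_product n y" .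
    moreover have "(\<Prod>j=1..<n. q * y j - y (Suc j)) \<noteq> 0"
      using generic_q_neq[OF that] by auto
    ultimately show ?thesis by simp
  qed
  note kernel = this
  show ?thesis
    unfolding qDS_def sum_T_perm[OF assms] sum_T_word_normal[OF assms]
  proof (rule sum.cong[OF refl])
    fix w assume "w \<in> {w. w permutes {1..n}}"
    with kernel[OF generic_comp[OF assms, of w]]
    show "f (x \<circ> w) / (\<Prod>j=1..<n. q * (x \<circ> w) j - (x \<circ> w) (Suc j)) * symmetrizer_kernel q n (x \<circ> w) =
      f (x \<circ> w) * (\<Prod>(a, b)\<in>far_pairs 1 n. q * x (w a) - x (w b)) / difference_product n (x \<circ> w)"
      by (simp add: times_divide_eq_right[symmetric] del: times_divide_eq_right)
  qed
qed

section \<open>Degree in a subset of the variables\<close>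

definition swap_invariant :: "nat set \<Rightarrow> ((nat \<Rightarrow> 'k) \<Rightarrow> 'k) \<Rightarrow> bool" where
  "swap_invariant A c \<longleftrightarrow> (\<forall>a\<in>A. \<forall>b\<in>A. \<forall>y. c (y \<circ> transpose a b) = c y)"

text \<open>Degree in the variables of \<^term>\<open>A\<close> only; the coefficients may be arbitrary functions that
  are symmetric in these variables.\<close>

inductive degree_le :: "nat set \<Rightarrow> nat \<Rightarrow> ((nat \<Rightarrow> 'k::field) \<Rightarrow> 'k) \<Rightarrow> bool" for A d where
  monomial: "swap_invariant A c \<Longrightarrow> sum e A \<le> d \<Longrightarrow> degree_le A d (\<lambda>y. c y * (\<Prod>i\<in>A. y i ^ e i))"
| add: "degree_le A d f \<Longrightarrow> degree_le A d g \<Longrightarrow> degree_le A d (\<lambda>y. f y + g y)"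

lemma swap_invariant_mult:
  "swap_invariant A c \<Longrightarrow> swap_invariant A c' \<Longrightarrow> swap_invariant A (\<lambda>y. c y * c' y)"
  by (simp add: swap_invariant_def)

lemma swap_invariant_const: "swap_invariant A (\<lambda>y. c)"
  by (simp add: swap_invariant_def)

lemma degree_le_invariant: "swap_invariant A c \<Longrightarrow> degree_le A d c"
  using degree_le.monomial[of A c "\<lambda>_. 0" d] by simp

lemma degree_le_mult:
  assumes "degree_le A d f" "degree_le A d' g"
  shows "degree_le A (d + d') (\<lambda>y. f y * g y)"
  using assms(1)
proof induction
  case (monomial c e)
  show ?case using assms(2)
  proof induction
    case (monomial c' e')
    have "degree_le A (d + d') (\<lambda>y. (c y * c' y) * (\<Prod>i\<in>A. y i ^ (e i + e' i)))"
      using \<open>swap_invariant A c\<close> \<open>sum e A \<le> d\<close> monomial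
      by (intro degree_le.monomial swap_invariant_mult) (simp_all add: sum.distrib)
    then show ?case by (simp add: power_add prod.distrib mult_ac)
  next
    case (add f g)
    then show ?case using degree_le.add by (simp add: distrib_left)
  qed
next
  case (add f f')
  then show ?case using degree_le.add by (simp add: distrib_right)
qed

lemma degree_le_prod:
  "(\<And>j. j \<in> J \<Longrightarrow> degree_le A (d j) (f j)) \<Longrightarrow> degree_le A (sum d J) (\<lambda>y. \<Prod>j\<in>J. f j y)"
proof (induction J rule: infinite_finite_induct)
  case (insert j J)
  then show ?case using degree_le_mult[of A "d j" "f j" "sum d J"] by simp
qed (simp_all add: degree_le_invariant swap_invariant_const)

lemma degree_le_power: "degree_le A d f \<Longrightarrow> degree_le A (d * k) (\<lambda>y. f y ^ k)"
  using degree_le_prod[of "{..<k}" A "\<lambda>_. d" "\<lambda>_. f"] by (simp add: mult.commute)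

lemma degree_le_sum:
  "(\<And>j. j \<in> J \<Longrightarrow> degree_le A d (f j)) \<Longrightarrow> degree_le A d (\<lambda>y. \<Sum>j\<in>J. f j y)"
proof (induction J rule: infinite_finite_induct)
  case (insert j J)
  then show ?case using degree_le.add[of A d "f j"] by simp
qed (simp_all add: degree_le_invariant swap_invariant_const)

lemma degree_le_var:
  assumes "finite A"
  shows "degree_le A 1 (\<lambda>y. y i :: 'k::field)"
proof (cases "i \<in> A")
  case True
  have "degree_le A 1 (\<lambda>y. 1 * (\<Prod>j\<in>A. y j ^ (if j = i then 1 else 0)) :: 'k)"
    using True assms by (intro degree_le.monomial swap_invariant_const) simp
  moreover have "(\<lambda>y. 1 * (\<Prod>j\<in>A. y j ^ (if j = i then 1 else 0))) = (\<lambda>y. y i :: 'k)"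
    using True assms by (subst prod.remove[of A i]) (auto intro!: prod.neutral)
  ultimately show ?thesis by (simp only:)
next
  case False
  then show ?thesis
    by (intro degree_le_invariant) (auto simp: swap_invariant_def transpose_def)
qed

lemma degree_le_linear: "finite A \<Longrightarrow> degree_le A 1 (\<lambda>y. q * y a - y b)"
  using degree_le.add[OF degree_le_mult[OF degree_le_invariant[OF swap_invariant_const[of A q], of 0] degree_le_var]
      degree_le_mult[OF degree_le_invariant[OF swap_invariant_const[of A "-1"], of 0] degree_le_var], of a b]
  by simp

text \<open>The maximum of m + 1 distinct naturals is at least m; removing it gives the induction.
  Applied to exponents, the bound forces a repetition in low degree.\<close>

lemma choose_two_le_sum: "finite (S :: nat set) \<Longrightarrow> card S choose 2 \<le> \<Sum>S"
proof (induction "card S" arbitrary: S)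
  case 0
  then show ?case by simp
next
  case (Suc m)
  then have "S \<noteq> {}" by auto
  let ?M = "Max S"
  have M: "?M \<in> S" using Suc \<open>S \<noteq> {}\<close> by simp
  have c: "card (S - {?M}) = m" using Suc M by simp
  have "S - {?M} \<subseteq> {..<?M}" using Suc by (auto simp: order_less_le)
  then have "m \<le> ?M" using card_mono[of "{..<?M}"] c by fastforce
  moreover have "m choose 2 \<le> \<Sum>(S - {?M})" using Suc.hyps(1)[of "S - {?M}"] Suc c by simp
  ultimately show ?case
    using sum.remove[OF Suc.prems M, of "\<lambda>x. x"] Suc.hyps(2)[symmetric] by (simp add: numeral_2_eq_2)
qed

lemma alternating_sum_low_degree:
  fixes f :: "(nat \<Rightarrow> 'k::field_char_0) \<Rightarrow> 'k"
  assumes "degree_le A d f" "A \<subseteq> {1..n}" "d < card A choose 2"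
  shows "(\<Sum>w\<in>{w. w permutes {1..n}}. f (x \<circ> w) / difference_product n (x \<circ> w)) = 0"
  using assms(1)
proof induction
  case (monomial c e)
  have fin: "finite A" using assms(2) finite_subset by blast
  have "\<not> inj_on e A"
  proof
    assume inj: "inj_on e A"
    have "card A choose 2 \<le> sum e A"
      using choose_two_le_sum[of "e ` A"] fin by (simp add: card_image[OF inj] sum.reindex[OF inj])
    then show False using monomial assms(3) by simp
  qed
  then obtain a b where ab: "a \<in> A" "b \<in> A" "a \<noteq> b" "e a = e b" by (auto simp: inj_on_def)
  let ?t = "transpose a b"
  have t: "?t permutes A" using ab by (simp add: permutes_swap_id)
  let ?m = "\<lambda>y. c y * (\<Prod>i\<in>A. y i ^ e i)"
  have m: "?m (y \<circ> ?t) = ?m y" for y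
  proof -
    have "(\<Prod>i\<in>A. y (?t i) ^ e i) = (\<Prod>i\<in>A. y (?t i) ^ e (?t i))"
      using ab(4) by (intro prod.cong) (auto simp: transpose_def)
    also have "\<dots> = (\<Prod>i\<in>A. y i ^ e i)"
      by (rule prod.reindex_bij_betw[OF permutes_imp_bij[OF t]])
    finally show ?thesis using monomial(1) ab by (simp add: swap_invariant_def)
  qed
  \<comment> \<open>The transposition fixes the monomial and negates the Vandermonde product, so
    right translation by it negates every summand.\<close>
  let ?F = "\<lambda>w. ?m (x \<circ> w) / difference_product n (x \<circ> w)"
  have "?F (w \<circ> ?t) = - ?F w" for w
    unfolding o_assoc m using difference_product_transpose[of a n b "x \<circ> w"] ab assms(2)
    by (subst difference_product_transpose) auto
  then have "sum ?F {w. w permutes {1..n}} = - sum ?F {w. w permutes {1..n}}"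
    using sum_permutes_comp_right[OF permutes_subset[OF t assms(2)], of ?F] by (simp add: sum_negf)
  \<comment> \<open>Characteristic zero allows division by 2.\<close>
  then have "sum ?F {w. w permutes {1..n}} = 0" by (simp only: eq_neg_iff_add_eq_0 flip: mult_2) simp
  then show ?case .
next
  case (add f g)
  then show ?case by (simp add: add_divide_distrib sum.distrib)
qed

lemma qDS_low_degree:
  fixes q :: "'k::field_char_0"
  assumes "generic q n x" "A \<subseteq> {1..n}" "d < card A choose 2"
    "degree_le A d (\<lambda>y. f y * (\<Prod>(a, b)\<in>far_pairs 1 n. q * y a - y b))"
  shows "qDS q n f x = 0"
  using alternating_sum_low_degree[OF assms(4,2,3), of x] by (simp add: qDS_explicit[OF assms(1)])

section \<open>Degree counts and vanishing of special symmetrizations\<close>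

lemma degree_le_far_pairs:
  assumes "finite A"
  shows "degree_le A ((m - l) choose 2) (\<lambda>y. \<Prod>(a, b)\<in>far_pairs l m. q * y a - y b)"
  using degree_le_prod[of "far_pairs l m" A "\<lambda>_. 1" "\<lambda>p y. q * y (fst p) - y (snd p)",
      OF degree_le_linear[OF assms]]
  by (simp add: card_far_pairs split_def)

lemma swap_invariant_outside:
  assumes "\<And>y z. (\<And>i. i \<notin> A \<Longrightarrow> y i = z i) \<Longrightarrow> c y = c z"
  shows "swap_invariant A c"
  unfolding swap_invariant_def
  by (intro ballI allI assms) (auto simp: transpose_def)

lemma swap_invariant_cross:
  assumes "A \<inter> B = {}" "C = A \<or> C = B"
  shows "swap_invariant C (\<lambda>y. \<Prod>(a, b)\<in>A \<times> B. q * y a - y b)"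
  unfolding swap_invariant_def
proof (intro ballI allI)
  fix a b y assume ab: "a \<in> C" "b \<in> C"
  let ?t = "map_prod (transpose a b) (transpose a b)"
  show "(\<Prod>(s, t)\<in>A \<times> B. q * (y \<circ> transpose a b) s - (y \<circ> transpose a b) t) = (\<Prod>(a, b)\<in>A \<times> B. q * y a - y b)"
    by (rule prod.reindex_bij_witness[where i = ?t and j = ?t])
      (use ab assms in \<open>auto simp: transpose_def\<close>)
qed

lemma swap_invariant_sum:
  assumes "A \<inter> S = {} \<or> A \<subseteq> S"
  shows "swap_invariant A (\<lambda>y. \<Sum>k\<in>S. y k)"
  unfolding swap_invariant_def
proof (intro ballI allI)
  fix a b y assume ab: "a \<in> A" "b \<in> A"
  show "(\<Sum>k\<in>S. (y \<circ> transpose a b) k) = (\<Sum>k\<in>S. y k)"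
    by (rule sum.reindex_bij_witness[where i = "transpose a b" and j = "transpose a b"])
      (use ab assms in \<open>auto simp: transpose_def\<close>)
qed

text \<open>\<open>J\<close> collects the indices whose partial sum may cut through
  \<open>A\<close>; all other partial sums are symmetric in \<open>A\<close> and count as
  coefficients.\<close>

lemma degree_le_ymon:
  assumes "finite A" "\<And>j. j \<in> {1..length e} - J \<Longrightarrow> A \<inter> {1..j} = {} \<or> A \<subseteq> {1..j}"
    "J \<subseteq> {1..length e}"
  shows "degree_le A (\<Sum>j\<in>J. e ! (j - 1)) (ymon e :: _ \<Rightarrow> 'k::field)"
proof -
  have "degree_le A ((if j \<in> J then 1 else 0) * e ! (j - 1)) (\<lambda>y. (\<Sum>k=1..j. y k :: 'k) ^ (e ! (j - 1)))"
    if "j \<in> {1..length e}" for j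
  proof (intro degree_le_power)
    show "degree_le A (if j \<in> J then 1 else 0) (\<lambda>y. \<Sum>k=1..j. y k :: 'k)"
    proof (cases "j \<in> J")
      case True
      then show ?thesis by (auto intro!: degree_le_sum degree_le_var[OF assms(1), simplified])
    next
      case False
      then have "A \<inter> {1..j} = {} \<or> A \<subseteq> {1..j}" using assms(2) that by blast
      then show ?thesis by (intro degree_le_invariant swap_invariant_sum)
    qed
  qed
  then have "degree_le A (\<Sum>j=1..length e. (if j \<in> J then 1 else 0) * e ! (j - 1))
      (\<lambda>y. \<Prod>j=1..length e. (\<Sum>k=1..j. y k :: 'k) ^ (e ! (j - 1)))"
    by (rule degree_le_prod)
  moreover have "(\<Sum>j=1..length e. (if j \<in> J then 1 else 0) * e ! (j - 1)) = (\<Sum>j\<in>J. e ! (j - 1))"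
    using assms(3) by (intro sum.mono_neutral_cong_right) auto
  moreover have "(\<lambda>y. \<Prod>j=1..length e. (\<Sum>k=1..j. y k :: 'k) ^ (e ! (j - 1))) = ymon e"
    by (simp add: ymon_def fun_eq_iff)
  ultimately show ?thesis by simp
qed

text \<open>The linear factor restores the missing adjacent pair and completes the rectangle of
  pairs between the two groups of variables. The full rectangle is symmetric in each group and costs
  no degree, while the other two products involve one group each.\<close>

lemma far_pairs_split:
  assumes "1 \<le> i" "i < n"
  shows "(q * y i - y (Suc i)) * (\<Prod>(a, b)\<in>far_pairs 1 n. q * y a - y b) =
    (\<Prod>(a, b)\<in>far_pairs 1 i. q * y a - y b) * (\<Prod>(a, b)\<in>far_pairs (Suc i) n. q * y a - y b)
      * (\<Prod>(a, b)\<in>{1..i} \<times> {Suc i..n}. q * y a - y (b::nat) :: 'k::field)"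
proof -
  have "insert (i, Suc i) (far_pairs 1 n) = far_pairs 1 i \<union> far_pairs (Suc i) n \<union> {1..i} \<times> {Suc i..n}"
    using assms by (auto simp: far_pairs_def)
  moreover have "(i, Suc i) \<notin> far_pairs 1 n" by (simp add: far_pairs_def)
  ultimately have "(q * y i - y (Suc i)) * (\<Prod>(a, b)\<in>far_pairs 1 n. q * y a - y b) =
    (\<Prod>(a, b)\<in>far_pairs 1 i \<union> far_pairs (Suc i) n \<union> {1..i} \<times> {Suc i..n}. q * y a - y b)"
    by (metis (mono_tags, lifting) finite_far_pairs prod.insert case_prod_conv)
  also have "\<dots> = (\<Prod>(a, b)\<in>far_pairs 1 i \<union> far_pairs (Suc i) n. q * y a - y b)
      * (\<Prod>(a, b)\<in>{1..i} \<times> {Suc i..n}. q * y a - y b)"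
  proof (rule prod.union_disjoint)
    show "(far_pairs 1 i \<union> far_pairs (Suc i) n) \<inter> {1..i} \<times> {Suc i..n} = {}"
      by (auto simp: far_pairs_def)
  qed auto
  also have "(\<Prod>(a, b)\<in>far_pairs 1 i \<union> far_pairs (Suc i) n. q * y a - y b) =
    (\<Prod>(a, b)\<in>far_pairs 1 i. q * y a - y b) * (\<Prod>(a, b)\<in>far_pairs (Suc i) n. q * y a - y b)"
  proof (rule prod.union_disjoint)
    show "far_pairs 1 i \<inter> far_pairs (Suc i) n = {}"
      by (auto simp: far_pairs_def)
  qed auto
  finally show ?thesis .
qed

lemma choose_two_Suc: "Suc m choose 2 = m + (m choose 2)"
  by (simp add: numeral_2_eq_2)

lemma sum_list_nth_Suc: "sum_list e = (\<Sum>j=1..length e. e ! (j - 1))"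
proof -
  have "(\<Sum>j=1..length e. e ! (j - 1)) = (\<Sum>j=0..<length e. e ! j)"
    by (rule sum.reindex_bij_witness[where i = Suc and j = "\<lambda>j. j - 1"]) auto
  then show ?thesis by (simp add: sum_list_sum_nth)
qed

text \<open>Powers of y_j with j < i cost degree only in the first \<open>i\<close> variables, those
  with j > i only in the others. If the former exponents sum to less than i - 1, the first group
  gives vanishing. Otherwise, as y_i takes at least one of the r - 1 units, the latter sum to less
  than r - i, and the second group does.\<close>

lemma qDS_linear_factor:
  fixes q :: "'k::field_char_0"
  assumes "length e = r" "Suc (sum_list e) = r" "i \<in> {1..r}" "1 \<le> e ! (i - 1)"
    and gen: "generic q (Suc r) x"
  shows "qDS q (Suc r) (\<lambda>y. ymon e y * (q * y i - y (Suc i))) x = 0"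
proof -
  let ?f = "\<lambda>y. ymon e y * (q * y i - y (Suc i))"
  let ?near = "\<lambda>y. \<Prod>(a, b)\<in>far_pairs 1 i. q * y a - y b"
  let ?far = "\<lambda>y. \<Prod>(a, b)\<in>far_pairs (Suc i) (Suc r). q * y a - y b"
  let ?cross = "\<lambda>y. \<Prod>(a, b)\<in>{1..i} \<times> {Suc i..Suc r}. q * y a - y b"
  have i: "1 \<le> i" "i < Suc r" using assms(3) by auto
  have split: "(\<lambda>y. ?f y * (\<Prod>(a, b)\<in>far_pairs 1 (Suc r). q * y a - y b)) =
    (\<lambda>y. ymon e y * (?near y * ?far y * ?cross y))"
    unfolding far_pairs_split[OF i, symmetric] by (simp only: mult.assoc)
  have inv: "swap_invariant {1..i} ?far" "swap_invariant {Suc i..Suc r} ?near"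
    by (rule swap_invariant_outside, rule prod.cong, auto simp: far_pairs_def)+
  have cross: "swap_invariant {1..i} ?cross" "swap_invariant {Suc i..Suc r} ?cross"
    by (rule swap_invariant_cross; auto)+
  have "{1..r} = ({1..<i} \<union> {i}) \<union> {Suc i..r}" using i by auto
  then have "(\<Sum>j=1..r. e ! (j - 1)) = (\<Sum>j=1..<i. e ! (j - 1)) + e ! (i - 1) + (\<Sum>j=Suc i..r. e ! (j - 1))"
    by (simp only:) (subst sum.union_disjoint; auto)+
  then have total: "Suc ((\<Sum>j=1..<i. e ! (j - 1)) + e ! (i - 1) + (\<Sum>j=Suc i..r. e ! (j - 1))) = r"
    using assms(1,2) by (simp add: sum_list_nth_Suc)
  show ?thesis
  proof (cases "(\<Sum>j=1..<i. e ! (j - 1)) < i - 1")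
    case True
    have "degree_le {1..i} ((\<Sum>j=1..<i. e ! (j - 1)) + (((i - 1) choose 2) + 0 + 0))
      (\<lambda>y. ymon e y * (?near y * ?far y * ?cross y))"
      using assms(1) i
      by (intro degree_le_mult degree_le_ymon degree_le_far_pairs degree_le_invariant inv cross) auto
    then show ?thesis
      using True i choose_two_Suc[of "i - 1"]
      by (intro qDS_low_degree[OF gen, of "{1..i}"], unfold split) (auto simp del: One_nat_def)
  next
    case False
    then have less: "(\<Sum>j=Suc i..r. e ! (j - 1)) < r - i" using total assms(4) i by linarith
    have "degree_le {Suc i..Suc r} ((\<Sum>j=Suc i..r. e ! (j - 1)) + (0 + ((Suc r - Suc i) choose 2) + 0))
      (\<lambda>y. ymon e y * (?near y * ?far y * ?cross y))"
      using assms(1) i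
      by (intro degree_le_mult degree_le_ymon degree_le_far_pairs degree_le_invariant inv cross) auto
    then show ?thesis
      using less i choose_two_Suc[of "r - i"]
      by (intro qDS_low_degree[OF gen, of "{Suc i..Suc r}"], unfold split) (auto simp: Suc_diff_le)
  qed
qed

text \<open>The extra factor is symmetric in all variables and costs no degree, which leaves r - 1 +
  (r choose 2), one below the bound. This accounts for the term omitted at the right end of
  (b).\<close>

lemma qDS_symmetric_factor:
  fixes q :: "'k::field_char_0"
  assumes "length e = r" "Suc (sum_list e) = r" and gen: "generic q (Suc r) x"
  shows "qDS q (Suc r) (\<lambda>y. (\<Sum>k=1..Suc r. y k) * ymon e y) x = 0"
proof (rule qDS_low_degree[OF gen, of "{1..Suc r}"])
  have "degree_le {1..Suc r} (0 + (\<Sum>j=1..length e. e ! (j - 1)) + ((Suc r - 1) choose 2))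
     (\<lambda>y. (\<Sum>k=1..Suc r. y k) * ymon e y * (\<Prod>(a, b)\<in>far_pairs 1 (Suc r). q * y a - y b))"
    by (intro degree_le_mult degree_le_ymon degree_le_far_pairs degree_le_invariant swap_invariant_sum) auto
  then show "degree_le {1..Suc r} (sum_list e + (r choose 2))
     (\<lambda>y. (\<Sum>k=1..Suc r. y k) * ymon e y * (\<Prod>(a, b)\<in>far_pairs 1 (Suc r). q * y a - y b))"
    by (simp add: sum_list_nth_Suc)
  show "sum_list e + (r choose 2) < card {1..Suc r} choose 2"
    using assms by (simp add: choose_two_Suc)
qed simp

section \<open>The relations for the remixed Eulerian numbers\<close>

lemma qDS_add:
  "generic q n x \<Longrightarrow> qDS q n (\<lambda>y. f y + g y) x = qDS q n f x + qDS q n g x"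
  by (simp add: qDS_explicit sum.distrib[symmetric] add_divide_distrib distrib_right)

lemma qDS_cmult: "generic q n x \<Longrightarrow> qDS q n (\<lambda>y. a * f y) x = a * qDS q n f x"
  by (simp add: qDS_explicit sum_distrib_left mult.assoc)

lemma T_word_const:
  "generic q n x \<Longrightarrow> is_word n js \<Longrightarrow> T_word q js (\<lambda>_. c) x = q ^ length js * c"
proof (induction js arbitrary: x)
  case (Cons j js)
  then have j: "j \<in> {1..<n}" "is_word n js" by (auto simp: is_word_def)
  have "x j - x (Suc j) \<noteq> 0" using generic_neq[OF Cons.prems(1), of j "Suc j"] j by auto
  moreover have "T_word q (j # js) (\<lambda>_. c) x = Tq q j (\<lambda>_. q ^ length js * c) x"
    unfolding T_word_Cons using j Cons by (intro Tq_cong[where n = n]) auto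
  ultimately show ?case by (simp add: Tq_explicit flip: left_diff_distrib) (simp add: algebra_simps)
qed simp

text \<open>The extra factor cancels the last factor of the denominator, so the inner sum is
  \<open>qDS\<close> in \<open>n\<close> variables, here the constant \<open>c\<close>. Each
  \<open>Tq\<close> multiplies a constant by \<open>q\<close>, and the coset representatives have
  lengths 0 to \<open>n\<close>.\<close>

lemma qDS_last_factor:
  assumes gen: "generic q (Suc n) x" and "1 \<le> n"
    and const: "\<And>y. generic q n y \<Longrightarrow> qDS q n g y = c"
  shows "qDS q (Suc n) (\<lambda>y. g y * (q * y n - y (Suc n))) x = qint q (Suc n) * c"
proof -
  let ?h = "\<lambda>y. g y * (q * y n - y (Suc n)) / (\<Prod>j=1..<Suc n. q * y j - y (Suc j))"
  let ?k = "\<lambda>y. g y / (\<Prod>j=1..<n. q * y j - y (Suc j))"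
  have h: "?h y = ?k y" if "generic q (Suc n) y" for y
    using generic_q_neq[OF that, of n "Suc n"] assms(2) by simp
  have inner: "(\<Sum>js\<in>normal_words n. T_word q js ?h y) = c" if y: "generic q (Suc n) y" for y
  proof -
    have "(\<Sum>js\<in>normal_words n. T_word q js ?h y) = (\<Sum>js\<in>normal_words n. T_word q js ?k y)"
    proof (intro sum.cong[OF refl] T_word_cong[OF h y])
      fix js assume "js \<in> normal_words n"
      from normal_words_is_word[OF this] show "is_word (Suc n) js" by (auto simp: is_word_def)
    qed
    also have "\<dots> = qDS q n g y"
      unfolding qDS_def by (rule sum_T_perm[symmetric]) (rule generic_mono[OF y], simp)
    finally show ?thesis using const[OF generic_mono[OF y]] by simp
  qed
  have "qDS q (Suc n) (\<lambda>y. g y * (q * y n - y (Suc n))) x =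
      (\<Sum>k=1..Suc n. T_word q [k..<Suc n] (\<lambda>y. \<Sum>js\<in>normal_words n. T_word q js ?h y) x)"
    unfolding qDS_def sum_T_perm[OF gen] sum_normal_words_Suc ..
  also have "\<dots> = (\<Sum>k=1..Suc n. q ^ (Suc n - k) * c)"
  proof (rule sum.cong[OF refl])
    fix k assume "k \<in> {1..Suc n}"
    then have w: "is_word (Suc n) [k..<Suc n]" by (auto simp: is_word_def)
    show "T_word q [k..<Suc n] (\<lambda>y. \<Sum>js\<in>normal_words n. T_word q js ?h y) x = q ^ (Suc n - k) * c"
      using T_word_cong[OF inner gen w] T_word_const[OF gen w, of c] by (simp only: length_upt)
  qed
  also have "\<dots> = (\<Sum>k=1..Suc n. q ^ (Suc n - k)) * c"
    by (simp only: sum_distrib_right)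
  also have "(\<Sum>k=1..Suc n. q ^ (Suc n - k)) = qint q (Suc n)"
    unfolding qint_def
    by (rule sum.reindex_bij_witness[where i = "\<lambda>k. Suc n - k" and j = "\<lambda>k. Suc n - k"]) auto
  finally show ?thesis .
qed

section \<open>q-integers and the three-term recurrence\<close>

lemma qint_Suc: "qint q (Suc m) = qint q m + q ^ m"
  and qint_0 [simp]: "qint q 0 = 0"
  by (simp_all add: qint_def)

lemma qint_nonzero:
  fixes q :: "'k::field_char_0"
  assumes "\<forall>m>0. q ^ m = 1 \<longrightarrow> q = 1" "0 < m"
  shows "qint q m \<noteq> 0"
proof (cases "q = 1")
  case True
  then show ?thesis using assms(2) by (simp add: qint_def)
next
  case False
  then have "q ^ m - 1 \<noteq> 0" using assms by auto
  then show ?thesis by (auto simp: power_diff_1_eq qint_def)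
qed

text \<open>The q-integers start at 0 and satisfy [t + 2] = (q + 1)[t + 1] - q[t], the same
  recurrence.\<close>

lemma qint_recurrence:
  assumes "u 0 = 0" "\<And>t. Suc t < L \<Longrightarrow> (q + 1) * u (Suc t) = q * u t + u (Suc (Suc t))"
  shows "t \<le> L \<Longrightarrow> u t = qint q t * u 1"
proof (induction t rule: less_induct)
  case (less t)
  consider "t = 0" | "t = 1" | s where "t = Suc (Suc s)"
    by (metis One_nat_def not0_implies_Suc)
  then show ?case
  proof cases
    case 3
    then have "u t = (q + 1) * u (Suc s) - q * u s" using assms(2)[of s] less.prems by simp
    also have "\<dots> = ((q + 1) * qint q (Suc s) - q * qint q s) * u 1"
      using less.IH[of s] less.IH[of "Suc s"] less.prems 3 by (simp add: algebra_simps)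
    finally show ?thesis using 3 by (simp add: qint_Suc algebra_simps)
  qed (simp_all add: assms(1) qint_Suc)
qed

lemma ymon_update:
  assumes "i < length e"
  shows "ymon (e[i := Suc (e ! i)]) y = (\<Sum>k=1..Suc i. y k) * ymon e y"
proof -
  let ?I = "{1..length e}" and ?s = "\<lambda>j. \<Sum>k=1..j. y k"
  have i: "Suc i \<in> ?I" using assms by auto
  have "(\<Prod>j\<in>?I - {Suc i}. ?s j ^ (e[i := Suc (e ! i)] ! (j - 1))) =
      (\<Prod>j\<in>?I - {Suc i}. ?s j ^ (e ! (j - 1)))"
    by (intro prod.cong refl) (auto simp: nth_list_update)
  then show ?thesis
    using assms prod.remove[OF _ i, of "\<lambda>j. ?s j ^ (e[i := Suc (e ! i)] ! (j - 1))"]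
      prod.remove[OF _ i, of "\<lambda>j. ?s j ^ (e ! (j - 1))"]
    by (simp add: ymon_def mult.assoc del: One_nat_def)
qed

lemma ymon_append_0: "ymon (c @ [0]) = ymon c"
proof -
  have "(\<Prod>i=1..length c. (\<Sum>k=1..i. y k) ^ ((c @ [0]) ! (i - 1))) =
      (\<Prod>i=1..length c. (\<Sum>k=1..i. y k) ^ (c ! (i - 1)))" for y :: "nat \<Rightarrow> 'a"
    by (intro prod.cong refl) (auto simp: nth_append)
  then show ?thesis by (simp add: ymon_def fun_eq_iff del: One_nat_def)
qed

text \<open>For the partial sums, (q + 1) y_i = q y_(i-1) + y_(i+1) + (q x_i - x_(i+1)), and the
  last term is annihilated by \<open>qDS_linear_factor\<close>.\<close>

lemma qDS_three_term:
  fixes q :: "'k::field_char_0"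
  assumes "length e = r" "Suc (sum_list e) = r" "i \<in> {1..r}" "1 \<le> e ! (i - 1)"
    and gen: "generic q (Suc r) x"
  defines "u \<equiv> \<lambda>i. qDS q (Suc r) (\<lambda>y. (\<Sum>k=1..i. y k) * ymon e y) x"
  shows "(q + 1) * u i = q * u (i - 1) + u (Suc i)"
proof -
  obtain i' where i: "i = Suc i'" using assms(3) by (cases i) auto
  have "(\<lambda>y. (q + 1) * ((\<Sum>k=1..i. y k) * ymon e y)) = (\<lambda>y. q * ((\<Sum>k=1..i - 1. y k) * ymon e y) +
      ((\<Sum>k=1..Suc i. y k) * ymon e y + ymon e y * (q * y i - y (Suc i))))" (is "?l = ?r")
  proof
    fix y :: "nat \<Rightarrow> 'k"
    have "(\<Sum>k=1..i. y k) = (\<Sum>k=1..i - 1. y k) + y i" by (simp add: i)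
    moreover have "(\<Sum>k=1..Suc i. y k) = (\<Sum>k=1..i. y k) + y (Suc i)" by simp
    ultimately show "?l y = ?r y" by (simp add: algebra_simps)
  qed
  then have "qDS q (Suc r) ?l x = qDS q (Suc r) ?r x" by simp
  then show ?thesis
    unfolding qDS_add[OF gen] qDS_cmult[OF gen] qDS_linear_factor[OF assms(1-4) gen]
    by (simp only: u_def add_0_right)
qed

lemma qDS_squarefree:
  fixes q :: "'k::field_char_0"
  assumes root: "\<forall>m>0. q ^ m = 1 \<longrightarrow> q = 1"
  shows "generic q (Suc r) x \<Longrightarrow> qDS q (Suc r) (ymon (replicate r 1)) x = qfact q r"
proof (induction r arbitrary: x)
  case 0
  have "{w. w permutes {1..1::nat}} = {id}" by (simp add: permutes_sing)
  moreover have "far_pairs 1 1 = {}" "difference_product 1 y = 1" for y :: "nat \<Rightarrow> 'k"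
    by (auto simp: far_pairs_def difference_product_def intro!: prod.neutral)
  ultimately show ?case
    using qDS_explicit[OF 0[unfolded One_nat_def[symmetric]], of "ymon []"]
    by (simp add: ymon_def qfact_def)
next
  case (Suc r)
  \<comment> \<open>One more slot, with exponent 0: \<open>u i\<close> is the value for y_1 ... y_r
    y_i in r + 2 variables.\<close>
  let ?e = "replicate r 1 @ [0::nat]"
  define u where "u i = qDS q (Suc (Suc r)) (\<lambda>y. (\<Sum>k=1..i. y k) * ymon ?e y) x" for i
  have e: "length ?e = Suc r" "Suc (sum_list ?e) = Suc r" by (simp_all add: sum_list_replicate)
  have "u 0 = 0" using qDS_cmult[OF Suc.prems, of 0] by (simp add: u_def)
  moreover have "(q + 1) * u (Suc t) = q * u t + u (Suc (Suc t))" if "Suc t < Suc r" for t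
    using qDS_three_term[OF e _ _ Suc.prems, of "Suc t"] that by (simp add: u_def nth_append)
  ultimately have u: "u t = qint q t * u 1" if "t \<le> Suc r" for t
    using qint_recurrence[of u "Suc r" q t] that by blast
  have end0: "u (Suc (Suc r)) = 0" unfolding u_def by (rule qDS_symmetric_factor[OF e Suc.prems])
  have "qDS q (Suc (Suc r)) (\<lambda>y. ymon ?e y * (q * y (Suc r) - y (Suc (Suc r)))) x =
      qint q (Suc (Suc r)) * qfact q r"
    unfolding ymon_append_0 by (rule qDS_last_factor[OF Suc.prems _ Suc.IH]) auto
  moreover have "(\<lambda>y. ymon ?e y * (q * y (Suc r) - y (Suc (Suc r)))) =
     (\<lambda>y. (q + 1) * ((\<Sum>k=1..Suc r. y k) * ymon ?e y) + (- q * ((\<Sum>k=1..r. y k) * ymon ?e y)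
      + - 1 * ((\<Sum>k=1..Suc (Suc r). y k) * ymon ?e y)))"
    by (simp add: fun_eq_iff algebra_simps)
  ultimately have "(q + 1) * u (Suc r) + (- q * u r + - 1 * u (Suc (Suc r))) = qint q (Suc (Suc r)) * qfact q r"
    unfolding u_def by (simp only: qDS_add[OF Suc.prems] qDS_cmult[OF Suc.prems])
  \<comment> \<open>Here (q + 1)[r + 1] - q[r] = [r + 2], a nonzero factor that is cancelled
    next.\<close>
  then have "qint q (Suc (Suc r)) * u 1 = qint q (Suc (Suc r)) * qfact q r"
    unfolding end0 u[of "Suc r", simplified] u[of r, simplified]
    by (simp add: qint_Suc algebra_simps)
  then have "u 1 = qfact q r" using qint_nonzero[OF root] by simp
  then have "u (Suc r) = qfact q (Suc r)" using u[of "Suc r"] by (simp add: qfact_def)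
  moreover have "replicate (Suc r) 1 = ?e[r := Suc (?e ! r)]"
    by (simp add: nth_append list_update_append replicate_append_same)
  then have "ymon (replicate (Suc r) 1) = (\<lambda>y. (\<Sum>k=1..Suc r. y k) * ymon ?e y :: 'k)"
    by (simp only:) (intro ext ymon_update, simp)
  ultimately show ?case by (simp only: u_def)
qed

section \<open>Exponent lists and relations (a), (b) at a fixed point\<close>

lemma sum_list_increment:
  "j < length e \<Longrightarrow> sum_list (e[j := Suc (e ! j)]) = Suc (sum_list (e :: nat list))"
  by (simp add: sum_list_update elem_le_sum_list)

lemma sum_list_transfer:
  assumes "i < length c" "j < length c" "1 \<le> c ! i"
  shows "sum_list ((c[i := c ! i - 1])[j := Suc (c[i := c ! i - 1] ! j)]) = sum_list (c :: nat list)"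
  using assms sum_list_increment[of j "c[i := c ! i - 1]"] elem_le_sum_list[of i c]
  by (simp add: sum_list_update)

text \<open>Read as increments of the common list \<open>c[i := c ! i - 1]\<close>, the terms of (b)
  become consecutive values of one sequence.\<close>

lemma transfer_left:
  assumes "i < length c" "1 \<le> i" "1 \<le> c ! i"
  shows "c[i - 1 := c ! (i - 1) + 1, i := c ! i - 1] =
    (c[i := c ! i - 1])[i - 1 := Suc (c[i := c ! i - 1] ! (i - 1))]"
  using assms by (intro nth_equalityI) (auto simp: nth_list_update)

lemma transfer_right:
  assumes "Suc i < length c" "1 \<le> c ! i"
  shows "c[i := c ! i - 1, Suc i := c ! Suc i + 1] =
    (c[i := c ! i - 1])[Suc i := Suc (c[i := c ! i - 1] ! Suc i)]"
  using assms by (intro nth_equalityI) (auto simp: nth_list_update)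

text \<open>The point \<open>x\<close> is fixed here; independence of \<open>x\<close> follows later
  from uniqueness.\<close>

lemma satisfies_ab_qDS:
  fixes q :: "'k::field_char_0"
  assumes root: "\<forall>m>0. q ^ m = 1 \<longrightarrow> q = 1" and gen: "generic q (Suc r) x"
  shows "satisfies_ab q r (\<lambda>c. qDS q (Suc r) (ymon c) x)"
  unfolding satisfies_ab_def
proof (intro conjI allI impI)
  show "qDS q (Suc r) (ymon (replicate r 1)) x = qfact q r"
    by (rule qDS_squarefree[OF root gen])
  fix c i assume c: "length c = r \<and> sum_list c = r" and i: "i < r" and ci: "2 \<le> c ! i"
  let ?e = "c[i := c ! i - 1]"
  define u where "u i = qDS q (Suc r) (\<lambda>y. (\<Sum>k=1..i. y k) * ymon ?e y) x" for i
  have e: "length ?e = r" "Suc (sum_list ?e) = r"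
    using c i ci elem_le_sum_list[of i c] by (auto simp: sum_list_update)
  have u: "qDS q (Suc r) (ymon (?e[j := Suc (?e ! j)])) x = u (Suc j)" if "j < r" for j
  proof -
    have "ymon (?e[j := Suc (?e ! j)]) = (\<lambda>y. (\<Sum>k=1..Suc j. y k) * ymon ?e y :: 'k)"
      using that e(1) by (intro ext ymon_update) simp
    then show ?thesis by (simp only: u_def)
  qed
  have "(q + 1) * u (Suc i) = q * u i + u (Suc (Suc i))"
    using qDS_three_term[OF e _ _ gen, of "Suc i"] i ci c by (simp add: u_def)
  \<comment> \<open>The zero values \<open>u 0\<close> and \<open>u (Suc r)\<close> stand for the
    terms omitted at the two ends.\<close>
  moreover have "u 0 = 0" using qDS_cmult[OF gen, of 0] by (simp add: u_def)
  moreover have "u (Suc r) = 0" unfolding u_def by (rule qDS_symmetric_factor[OF e gen])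
  moreover have "?e[i := Suc (?e ! i)] = c" using c i ci by simp
  then have "qDS q (Suc r) (ymon c) x = u (Suc i)" using u[OF i] by simp
  moreover have "qDS q (Suc r) (ymon (c[i - 1 := c ! (i - 1) + 1, i := c ! i - 1])) x = u i" if "i \<noteq> 0"
    using u[of "i - 1"] transfer_left[of i c] that c i ci by simp
  moreover have "qDS q (Suc r) (ymon (c[i := c ! i - 1, Suc i := c ! Suc i + 1])) x = u (Suc (Suc i))"
    if "i \<noteq> r - 1"
    using u[of "Suc i"] transfer_right[of i c] that c i ci by simp
  moreover have "Suc i = r" if "i = r - 1" using that i by simp
  ultimately show "(q + 1) * qDS q (Suc r) (ymon c) x =
     (if i = 0 then 0 else q * qDS q (Suc r) (ymon (c[i - 1 := c ! (i - 1) + 1, i := c ! i - 1])) x) +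
     (if i = r - 1 then 0 else qDS q (Suc r) (ymon (c[i := c ! i - 1, Suc i := c ! Suc i + 1])) x)"
    by (cases "i = 0"; cases "i = r - 1") simp_all
qed

section \<open>Uniqueness and the theorem\<close>

text \<open>Meant for the difference of two solutions; the induction is on the number of zero
  entries.\<close>

lemma homogeneous_family_zero:
  fixes q :: "'k::field_char_0"
  assumes root: "\<forall>m>0. q ^ m = 1 \<longrightarrow> q = 1"
    and D1: "D (replicate r 1) = 0"
    and rel: "\<And>c i. length c = r \<Longrightarrow> sum_list c = r \<Longrightarrow> i < r \<Longrightarrow> 2 \<le> c ! i \<Longrightarrow>
      (q + 1) * D c = (if i = 0 then 0 else q * D (c[i - 1 := c ! (i - 1) + 1, i := c ! i - 1]))
       + (if i = r - 1 then 0 else D (c[i := c ! i - 1, Suc i := c ! Suc i + 1]))"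
  shows "length c = r \<Longrightarrow> sum_list c = r \<Longrightarrow> D c = 0"
proof (induction "card {j. j < r \<and> c ! j = 0}" arbitrary: c rule: less_induct)
  case less
  note c = less.prems
  show ?case
  proof (cases "\<exists>i<r. 2 \<le> c ! i")
    case False
    then have le: "c ! j \<le> 1" if "j < r" for j using that by force
    have "c ! j = 1" if "j < r" for j
    proof (rule ccontr)
      assume "c ! j \<noteq> 1"
      then have "c ! j < 1" using le[OF that] by linarith
      then have "sum ((!) c) {0..<r} < sum (\<lambda>_. 1) {0..<r}"
        using that le by (intro sum_strict_mono_ex1) (auto intro!: bexI[of _ j])
      then show False using c by (simp add: sum_list_sum_nth)
    qed
    then have "c = replicate r 1" using c by (intro nth_equalityI) auto
    then show ?thesis using D1 by simp
  next
    case True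
    then obtain i where i: "i < r" "2 \<le> c ! i" by blast
    \<comment> \<open>Positions are 1-based, with 0 and everything beyond \<open>r\<close> counted
      as zeros. \<open>p\<close> is the nearest such position left of \<open>Suc i\<close>, and
      \<open>s\<close> the nearest to its right.\<close>
    let ?z = "\<lambda>j. j = 0 \<or> r < j \<or> c ! (j - 1) = 0"
    define p where "p = Max {j. j \<le> i \<and> ?z j}"
    define s where "s = (LEAST j. Suc i < j \<and> ?z j)"
    have "p \<in> {j. j \<le> i \<and> ?z j}" unfolding p_def by (rule Max_in) auto
    then have p: "p \<le> i" "?z p" by auto
    have p_max: "\<not> ?z j" if "p < j" "j \<le> i" for j
    proof
      assume "?z j"
      then have "j \<le> p" unfolding p_def using that(2) by (intro Max_ge) auto
      then show False using that(1) by simp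
    qed
    have "Suc i < s \<and> ?z s"
      unfolding s_def by (rule LeastI[of _ "Suc r"]) (use i in auto)
    then have s: "Suc i < s" "?z s" by auto
    have s_min: "\<not> ?z j" if "Suc i < j" "j < s" for j
      using not_less_Least[of j "\<lambda>j. Suc i < j \<and> ?z j"] that by (auto simp: s_def)
    have between: "1 \<le> j \<and> j \<le> r \<and> 1 \<le> c ! (j - 1)" if "p < j" "j < s" for j
    proof -
      consider "j \<le> i" | "j = Suc i" | "Suc i < j" by linarith
      then show ?thesis using p_max[of j] s_min[of j] that i by cases auto
    qed
    let ?e = "c[i := c ! i - 1]"
    \<comment> \<open>\<open>v j\<close> is the value with the surplus unit moved from position
      \<open>Suc i\<close> to position \<open>j\<close>; the default 0 encodes the omitted
      terms.\<close>
    define v where "v j = (if 1 \<le> j \<and> j \<le> r then D (?e[j - 1 := Suc (?e ! (j - 1))]) else 0)" for j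
    have vD: "D (?e[j := Suc (?e ! j)]) = v (Suc j)" if "j < r" for j
      using that by (simp add: v_def)
    have e: "length ?e = r" "Suc (sum_list ?e) = r"
      using c i elem_le_sum_list[of i c] by (auto simp: sum_list_update)
    have sum_e: "sum_list (?e[j := Suc (?e ! j)]) = r" if "j < r" for j
      using sum_list_increment[of j ?e] that e by simp
    \<comment> \<open>A unit placed on a zero entry removes that zero, and entry \<open>i\<close>
      stays positive because \<open>c ! i\<close> is at least 2, so the induction hypothesis
      applies.\<close>
    have v0: "v j = 0" if "?z j" for j
    proof (cases "1 \<le> j \<and> j \<le> r")
      case True
      then have z: "c ! (j - 1) = 0" "j - 1 < r" using that by auto
      then have "j - 1 \<noteq> i" using i by auto
      let ?c = "?e[j - 1 := Suc (?e ! (j - 1))]"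
      have "{l. l < r \<and> ?c ! l = 0} \<subset> {l. l < r \<and> c ! l = 0}"
        using z i c \<open>j - 1 \<noteq> i\<close> by (auto simp: nth_list_update split: if_splits)
      then have "card {l. l < r \<and> ?c ! l = 0} < card {l. l < r \<and> c ! l = 0}"
        by (intro psubset_card_mono) auto
      then have "D ?c = 0" using sum_e[OF z(2)] c by (intro less.hyps) auto
      then show ?thesis by (simp add: v_def)
    qed (auto simp: v_def)
    have "(q + 1) * v (p + Suc t) = q * v (p + t) + v (p + Suc (Suc t))" if t: "Suc t < s - p" for t
    proof -
      let ?j = "p + t"
      have "p + Suc t < s" using t by linarith
      then have j: "?j < r" "1 \<le> c ! ?j" using between[of "p + Suc t"] by auto
      \<comment> \<open>Inside the block every entry of \<open>?e\<close> is positive, so the one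
        receiving the unit reaches 2 and \<open>rel\<close> applies.\<close>
      then have ej: "1 \<le> ?e ! ?j" using i c by (cases "?j = i") auto
      let ?c = "?e[?j := Suc (?e ! ?j)]"
      have lc: "length ?c = r" "?c ! ?j = Suc (?e ! ?j)" using j c by auto
      have ce: "?c[?j := ?c ! ?j - 1] = ?e" using lc j c by simp
      have "D (?c[?j - 1 := ?c ! (?j - 1) + 1, ?j := ?c ! ?j - 1]) = v ?j" if "?j \<noteq> 0"
      proof -
        have "1 \<le> ?j" "?j < length ?c" "1 \<le> ?c ! ?j" using that lc j by auto
        then have "D (?c[?j - 1 := ?c ! (?j - 1) + 1, ?j := ?c ! ?j - 1]) = v (Suc (?j - 1))"
          using j(1) by (simp only: transfer_left ce) (rule vD, simp)
        moreover have "Suc (?j - 1) = ?j" using that by simp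
        ultimately show ?thesis by (simp only:)
      qed
      moreover have "v 0 = 0" by (simp add: v_def)
      moreover have "D (?c[?j := ?c ! ?j - 1, Suc ?j := ?c ! Suc ?j + 1]) = v (Suc (Suc ?j))" if "?j \<noteq> r - 1"
      proof -
        have "Suc ?j < r" "Suc ?j < length ?c" "1 \<le> ?c ! ?j" using that lc j by auto
        then show ?thesis by (simp only: transfer_right) (simp only: ce vD)
      qed
      moreover have "v (Suc (Suc ?j)) = 0" if "?j = r - 1" using that j by (simp add: v_def)
      moreover have "D ?c = v (Suc ?j)" using j by (simp add: v_def)
      ultimately have "(q + 1) * v (Suc ?j) = q * v ?j + v (Suc (Suc ?j))"
        using rel[of ?c ?j] lc j ej sum_e[OF j(1)]
        by (cases "?j = 0"; cases "?j = r - 1") simp_all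
      then show ?thesis by simp
    qed
    then have u: "v (p + t) = qint q t * v (p + 1)" if "t \<le> s - p" for t
      using qint_recurrence[of "\<lambda>t. v (p + t)" "s - p" q t] v0[OF p(2)] that by simp
    \<comment> \<open>The sequence vanishes at its right end while the q-integer there does not, so
      its initial factor is 0.\<close>
    have "qint q (s - p) * v (p + 1) = 0"
      using u[of "s - p"] v0[OF s(2)] p s by simp
    then have "v (p + 1) = 0" using qint_nonzero[OF root, of "s - p"] p s by simp
    then have "v (Suc i) = 0" using u[of "Suc i - p"] p s by simp
    moreover have "?e[i := Suc (?e ! i)] = c" using c i by simp
    ultimately show ?thesis using i by (simp add: v_def)
  qed
qed

lemma satisfies_ab_unique:
  fixes q :: "'k::field_char_0"
  assumes "\<forall>m>0. q ^ m = 1 \<longrightarrow> q = 1" "satisfies_ab q r A" "satisfies_ab q r B"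
    "length c = r" "sum_list c = r"
  shows "A c = B c"
proof -
  have "A c - B c = 0"
  proof (rule homogeneous_family_zero[where D = "\<lambda>c. A c - B c", OF assms(1) _ _ assms(4,5)])
    show "A (replicate r 1) - B (replicate r 1) = 0"
      using assms(2,3) by (simp add: satisfies_ab_def)
    fix c i assume *: "length c = r" "sum_list c = r" "i < r" "2 \<le> c ! i"
    let ?l = "c[i - 1 := c ! (i - 1) + 1, i := c ! i - 1]" and ?r = "c[i := c ! i - 1, Suc i := c ! Suc i + 1]"
    have "(q + 1) * F c = (if i = 0 then 0 else q * F ?l) + (if i = r - 1 then 0 else F ?r)"
      if "satisfies_ab q r F" for F
      using that * unfolding satisfies_ab_def by blast
    from this[OF assms(2)] this[OF assms(3)]
    show "(q + 1) * (A c - B c) = (if i = 0 then 0 else q * (A ?l - B ?l)) + (if i = r - 1 then 0 else A ?r - B ?r)"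
      by (simp add: right_diff_distrib split: if_splits)
  qed
  then show ?thesis by simp
qed

text \<open>Coordinates are chosen one at a time outside a finite set. Nonzero coordinates handle
  \<open>q = 0\<close>, where \<open>q * t \<noteq> x i\<close> amounts to
  \<open>x i \<noteq> 0\<close>.\<close>

lemma generic_nonzero_exists:
  "\<exists>x. generic (q :: 'k::field_char_0) n x \<and> (\<forall>i\<in>{1..n}. x i \<noteq> 0)"
proof (induction n)
  case 0
  then show ?case by (simp add: generic_def)
next
  case (Suc n)
  then obtain x where x: "generic q n x" "\<And>i. i \<in> {1..n} \<Longrightarrow> x i \<noteq> 0" by blast
  have "finite (insert 0 (\<Union>i\<in>{1..n}. {x i, q * x i, x i / q}))" by simp
  then obtain t where "t \<notin> insert 0 (\<Union>i\<in>{1..n}. {x i, q * x i, x i / q})"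
    using ex_new_if_finite[OF infinite_UNIV_char_0] by blast
  then have t: "t \<noteq> 0" "\<And>i. i \<in> {1..n} \<Longrightarrow> t \<noteq> x i \<and> q * x i \<noteq> t \<and> x i / q \<noteq> t" by auto
  have qt: "q * t \<noteq> x i" if "i \<in> {1..n}" for i
    using t(2)[OF that] x(2)[OF that] by (cases "q = 0") (auto simp: field_simps)
  let ?x = "x(Suc n := t)"
  have "generic q (Suc n) ?x"
    unfolding generic_def
  proof (intro ballI impI)
    fix i j assume ij: "i \<in> {1..Suc n}" "j \<in> {1..Suc n}" "i \<noteq> j"
    then consider "i = Suc n" "j \<in> {1..n}" | "j = Suc n" "i \<in> {1..n}" | "i \<in> {1..n}" "j \<in> {1..n}"
      by fastforce
    then show "?x i \<noteq> ?x j \<and> q * ?x i \<noteq> ?x j"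
    proof cases
      case 1
      then show ?thesis using t(2)[of j] qt[of j] by auto
    next
      case 2
      then show ?thesis using t(2)[of i] by auto
    next
      case 3
      then show ?thesis using generic_neq[OF x(1), of i j] generic_q_neq[OF x(1), of i j] ij(3) by auto
    qed
  qed
  moreover have "\<forall>i\<in>{1..Suc n}. ?x i \<noteq> 0" using x(2) t(1) by auto
  ultimately show ?case by blast
qed

theorem theorem1p2:
  fixes q :: "'k::field_char_0" and r :: nat
  assumes "r \<ge> 1"
    and "\<forall>m>0. q ^ m = 1 \<longrightarrow> q = 1"
  shows "satisfies_ab q r (remixed_eulerian q)
    \<and> (\<forall>B. satisfies_ab q r B \<longrightarrow>
          (\<forall>c. length c = r \<and> sum_list c = r \<longrightarrow> B c = remixed_eulerian q c))"
proof -
  obtain x where x: "generic q (Suc r) x" using generic_nonzero_exists by blast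
  define A where "A c = qDS q (Suc r) (ymon c) x" for c
  have A: "satisfies_ab q r A" unfolding A_def by (rule satisfies_ab_qDS[OF assms(2) x])
  \<comment> \<open>The values at any two generic points form families satisfying (a) and (b), hence
    agree; the existence of \<open>x\<close> makes the constant unique.\<close>
  have eq: "remixed_eulerian q c = A c" if c: "length c = r" "sum_list c = r" for c
    unfolding remixed_eulerian_def c(1)
  proof (rule the_equality)
    show "\<forall>y. generic q (r + 1) y \<longrightarrow> qDS q (r + 1) (ymon c) y = A c"
      using satisfies_ab_unique[OF assms(2) satisfies_ab_qDS[OF assms(2)] A c] by simp
    fix a assume "\<forall>y. generic q (r + 1) y \<longrightarrow> qDS q (r + 1) (ymon c) y = a"
    then show "a = A c" using x by (simp add: A_def)
  qed
  have "satisfies_ab q r (remixed_eulerian q)"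
    unfolding satisfies_ab_def
  proof (intro conjI allI impI)
    show "remixed_eulerian q (replicate r 1) = qfact q r"
      using A by (simp add: eq sum_list_replicate satisfies_ab_def)
    fix c i assume c: "length c = r \<and> sum_list c = r" and i: "i < r" "2 \<le> c ! i"
    let ?l = "c[i - 1 := c ! (i - 1) + 1, i := c ! i - 1]" and ?r = "c[i := c ! i - 1, Suc i := c ! Suc i + 1]"
    have "(q + 1) * A c = (if i = 0 then 0 else q * A ?l) + (if i = r - 1 then 0 else A ?r)"
      using A c i unfolding satisfies_ab_def by blast
    \<comment> \<open>\<open>eq\<close> requires length and sum \<open>r\<close>, and moving one
      unit preserves both.\<close>
    moreover have "remixed_eulerian q ?l = A ?l" if "i \<noteq> 0"
      using sum_list_transfer[of i c "i - 1"] transfer_left[of i c] c i that by (intro eq) auto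
    moreover have "remixed_eulerian q ?r = A ?r" if "i \<noteq> r - 1"
      using sum_list_transfer[of i c "Suc i"] transfer_right[of i c] c i that by (intro eq) auto
    ultimately show "(q + 1) * remixed_eulerian q c =
        (if i = 0 then 0 else q * remixed_eulerian q ?l) + (if i = r - 1 then 0 else remixed_eulerian q ?r)"
      using c by (cases "i = 0"; cases "i = r - 1") (simp_all only: eq if_True if_False simp_thms)
  qed
  moreover have "B c = remixed_eulerian q c" if "satisfies_ab q r B" "length c = r" "sum_list c = r" for B c
    using satisfies_ab_unique[OF assms(2) that(1) A that(2,3)] eq[OF that(2,3)] by simp
  ultimately show ?thesis by blast
qed

end
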